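(* For $N\ge1$, let $(a_{N,k})_{0\le k\le N}$ be an array of complex random variables such that $\mathbb P\{a_{N,0}=0\}=0$ and $\mathbb P\{a_{N,N}=0\}=0$ for all $N$. (No independence or identical distribution is assumed.) Let $$L_N=\log\left(\sum_{k=0}^{N}|a_{N,k}|\right)-\frac12\log|a_{N,0}|-\frac12\log|a_{N,N}|,$$ and let $P_N(Z)=\sum_{k=0}^N a_{N,k}Z^k$. (i) If $\mathbb E[L_N]=o(N)$ as $N\to\infty$, then there exists a positive (deterministic) function $\alpha_N$ satisfying $\alpha_N=o(N)$ such that $$\lim_{N\to\infty}\mathbb E\left[\frac1N\nu_N\left(\frac{\alpha_N}{N}\right)\right]=1$$ and, for all $0\le\theta<\phi\le2\pi$, $$\lim_{N\to\infty}\mathbb E\left[\frac1N\nu_N(\theta,\phi)\right]=\frac{\phi-\theta}{2\pi}.$$ In fact, $\frac1N\nu_N(\alpha_N/N)\to1$ and $\frac1N\nu_N(\theta,\phi)\to\frac{\phi-\theta}{2\pi}$ also in probability and in the $p$-th mean, for all positive $p$. (ii) Furthermore, if there exists a deterministic positive function $\alpha_N$ satisfying $\alpha_N\le N$ for all $N$ such that $L_N=o(\alpha_N)$ almost surely, then, for this $\alpha_N$, both convergences $\frac1N\nu_N(\alpha_N/N)\to1$ and $\frac1N\nu_N(\theta,\phi)\to\frac{\phi-\theta}{2\pi}$ (for all $0\le\theta<\phi\le2\pi$) hold almost surely, and also in the $p$-th mean, for all positive $p$.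
   Context: All random variables are defined on one probability space $(\Omega,\mathcal F,\mathbb P)$ with expectation $\mathbb E$. Almost surely $a_{N,0}a_{N,N}\ne0$; let $z_1,\dots,z_N$ be the complex zeros of $P_N$, counted with multiplicity. For $0\le\rho\le1$, $\nu_N(\rho)=\#\{k:1-\rho\le|z_k|\le\frac1{1-\rho}\}$, with $\frac{1}{1-\rho}$ read as $+\infty$ when $\rho=1$ (when $\alpha_N=o(N)$, $\nu_N(\alpha_N/N)$ is considered for those $N$ with $\alpha_N\le N$, i.e. for all sufficiently large $N$). For $0\le\theta<\phi\le2\pi$, $\nu_N(\theta,\phi)=\#\{k:\theta\le\arg(z_k)<\phi\}$, where the argument takes values in $[0,2\pi)$. Convergence $X_N\to X$ in the $p$-th mean means $\mathbb E[|X_N-X|^p]\to0$. "$L_N=o(\alpha_N)$ almost surely" means $L_N/\alpha_N\to0$ almost surely. *)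

theory Defs
  imports "HOL-Probability.Probability" "HOL-Library.Landau_Symbols"
begin

definition row_poly :: "(nat \<Rightarrow> nat \<Rightarrow> 'w \<Rightarrow> complex) \<Rightarrow> nat \<Rightarrow> 'w \<Rightarrow> complex poly" where
  "row_poly a N \<omega> = (\<Sum>k\<le>N. monom (a N k \<omega>) k)"

definition log_ratio :: "(nat \<Rightarrow> nat \<Rightarrow> 'w \<Rightarrow> complex) \<Rightarrow> nat \<Rightarrow> 'w \<Rightarrow> real" where
  "log_ratio a N \<omega> =
     ln (\<Sum>k\<le>N. norm (a N k \<omega>)) - ln (norm (a N 0 \<omega>)) / 2 - ln (norm (a N N \<omega>)) / 2"

(* proots is the multiset of zeros, so these counts include multiplicities.  The upper radius
   1 / (1 - \<rho>) is read as infinite for \<rho> = 1, where HOL division would give 0. *)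
definition annulus_count :: "complex poly \<Rightarrow> real \<Rightarrow> nat" where
  "annulus_count p \<rho> =
     size {#z \<in># proots p. 1 - \<rho> \<le> norm z \<and> (\<rho> = 1 \<or> norm z \<le> 1 / (1 - \<rho>))#}"

definition sector_count :: "complex poly \<Rightarrow> real \<Rightarrow> real \<Rightarrow> nat" where
  "sector_count p \<theta> \<phi> = size {#z \<in># proots p. \<theta> \<le> Arg2pi z \<and> Arg2pi z < \<phi>#}"

(* Bochner integrals of non-integrable functions and measures of non-measurable sets are 0 in HOL,
   so measurability and integrability are part of the two modes of convergence below.  They are
   required for all sufficiently large indices, which is where the limit is determined. *)
definition converges_in_probability ::
    "'w measure \<Rightarrow> (nat \<Rightarrow> 'w \<Rightarrow> real) \<Rightarrow> ('w \<Rightarrow> real) \<Rightarrow> bool" where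
  "converges_in_probability M X Y \<longleftrightarrow>
     (\<forall>\<^sub>F n in sequentially. X n \<in> borel_measurable M) \<and> Y \<in> borel_measurable M \<and>
     (\<forall>\<epsilon>>0. (\<lambda>n. measure M {\<omega> \<in> space M. \<bar>X n \<omega> - Y \<omega>\<bar> > \<epsilon>}) \<longlonglongrightarrow> 0)"

definition converges_in_mean ::
    "'w measure \<Rightarrow> real \<Rightarrow> (nat \<Rightarrow> 'w \<Rightarrow> real) \<Rightarrow> ('w \<Rightarrow> real) \<Rightarrow> bool" where
  "converges_in_mean M p X Y \<longleftrightarrow>
     (\<forall>\<^sub>F n in sequentially. X n \<in> borel_measurable M \<and>
        integrable M (\<lambda>\<omega>. \<bar>X n \<omega> - Y \<omega>\<bar> powr p)) \<and> Y \<in> borel_measurable M \<and>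
     (\<lambda>n. \<integral>\<omega>. \<bar>X n \<omega> - Y \<omega>\<bar> powr p \<partial>M) \<longlonglongrightarrow> 0"

end

theory Submission
  imports Defs "HOL-Complex_Analysis.Complex_Analysis"
    "HOL-Computational_Algebra.Fundamental_Theorem_Algebra"
begin

text \<open>
Two deterministic estimates, both linear in \<open>L\<close> and uniform in the polynomial, carry the theorem.

The first is Jensen's inequality in the form \<open>(\<Sum>z. \<bar>ln (norm z)\<bar>) \<le> 2 * L\<close>, the sum being over the
zeros of the polynomial (\<open>sum_abs_ln_norm_roots_le\<close>).  A zero outside the annulus with parameter
\<open>\<rho>\<close> contributes at least \<open>\<rho>\<close>, so at most \<open>2 * L / \<rho>\<close> zeros lie outside; with
\<open>\<rho> = \<alpha> / N\<close> the proportion of such zeros is at most \<open>2 * L / \<alpha>\<close>.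

The second is an equidistribution estimate for the arguments.  Projecting the zeros radially onto the
unit circle yields points \<open>u\<close> with \<open>norm (\<Prod>u. w - u) \<le> exp L\<close> for all \<open>w\<close> on the circle
(\<open>norm_prod_sgn_roots_le\<close>).  The logarithm of the product \<open>\<Prod>u. 1 - w * cnj u\<close> is holomorphic in the
disc, vanishes at the origin, has real part at most \<open>L\<close>, and its Taylor coefficients are the power
sums of the points up to conjugation and the factor \<open>- 1 / k\<close>.  A function with bounded real part has
bounded coefficients, so \<open>norm (\<Sum>u. u ^ k) \<le> 2 * k * L\<close>
(\<open>norm_power_sum_le_of_norm_prod_le\<close>).  Approximating the indicator of an arc by trigonometric
polynomials as in Weyl's criterion gives, for every \<open>e > 0\<close>, a constant \<open>C\<close> with
\<open>\<bar>count / N - (\<phi> - \<theta>) / (2 * pi)\<bar> \<le> e + C * L / N\<close> (\<open>sector_count_equidistribution\<close>).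

The probabilistic statements follow.  If \<open>\<alpha> \<le> N\<close> and \<open>L / \<alpha> \<longlonglongrightarrow> 0\<close> at a sample point, both proportions
converge there.  If only \<open>E L / N \<longlonglongrightarrow> 0\<close>, choose \<open>\<alpha>\<close> with \<open>E L / \<alpha> \<longlonglongrightarrow> 0\<close> and \<open>\<alpha> / N \<longlonglongrightarrow> 0\<close>;
Markov's inequality then gives convergence in probability.  Since proportions lie between zero and one,
either mode of convergence upgrades to convergence in every \<open>p\<close>-th mean.  That the counts are random
variables at all rests on the description of ``at least \<open>m\<close> zeros in a compact set'' as the
solvability of an equation over a compact set of candidate zeros (\<open>root_count_ge_iff\<close>).
\<close>

section \<open>Jensen's inequality for the zeros of a polynomial\<close>

lemma poly_max_modulus:
  fixes q :: "complex poly"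
  assumes "\<And>w. norm w = 1 \<Longrightarrow> norm (poly q w) \<le> B" and "norm z \<le> 1"
  shows "norm (poly q z) \<le> B"
proof (rule maximum_modulus_frontier[of "poly q" "cball 0 1" B z])
  show "poly q holomorphic_on interior (cball 0 1)"
    by (intro holomorphic_intros)
  show "continuous_on (closure (cball 0 1)) (poly q)"
    by (intro continuous_intros)
qed (use assms in auto)

text \<open>
The quantity \<open>L\<close> of the theorem for a single polynomial: \<open>L = 0\<close> forces all zeros
onto the unit circle, and \<open>L\<close> small compared with the degree forces most of them close to it.
\<close>
definition poly_log_ratio :: "complex poly \<Rightarrow> real" where
  "poly_log_ratio p = ln (\<Sum>k\<le>degree p. norm (coeff p k))
     - ln (norm (coeff p 0)) / 2 - ln (norm (lead_coeff p)) / 2"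

lemma norm_poly_le_sum_norm_coeff:
  fixes p :: "complex poly"
  assumes "norm w = 1"
  shows "norm (poly p w) \<le> (\<Sum>k\<le>degree p. norm (coeff p k))"
proof -
  have "norm (poly p w) \<le> (\<Sum>k\<le>degree p. norm (coeff p k * w ^ k))"
    unfolding poly_altdef by (rule norm_sum)
  then show ?thesis using assms by (simp add: norm_mult norm_power)
qed

text \<open>
Schur's observation: with \<open>x = r u\<close> and \<open>r = norm x\<close>, one has
\<open>norm (w - x)\<^sup>2 / r = r + 1 / r - 2 * (w \<bullet> u)\<close>, and this is smallest at \<open>r = 1\<close> because
\<open>r + 1 / r \<ge> 2\<close>.  Moving every zero radially onto the unit circle therefore enlarges the
product of the distances at most by the square root of the product of the \<open>1 / norm x\<close>.
\<close>
lemma norm_diff_sgn_le: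
  fixes w x :: complex
  assumes "norm w = 1" "x \<noteq> 0"
  shows "norm (w - sgn x) \<le> norm (w - x) / sqrt (norm x)"
proof -
  define r where "r = norm x"
  define u where "u = sgn x"
  have r: "r > 0" and u: "norm u = 1" using assms(2) by (auto simp: r_def u_def norm_sgn)
  have x: "x = of_real r * u" using assms(2) by (simp add: r_def u_def sgn_eq)
  have sq: "(norm (w - of_real t * u))\<^sup>2 = 1 + t\<^sup>2 - 2 * t * (w \<bullet> u)" for t
  proof -
    have "(norm (w - t *\<^sub>R u))\<^sup>2 = w \<bullet> w - 2 * t * (w \<bullet> u) + t * t * (u \<bullet> u)"
      unfolding power2_norm_eq_inner inner_diff_left inner_diff_right inner_scaleR_left inner_scaleR_right
      by (simp add: inner_commute[of u w] algebra_simps)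
    then show ?thesis unfolding scaleR_conv_of_real using assms(1) u by (simp add: dot_square_norm power2_eq_square)
  qed
  have "r * (norm (w - u))\<^sup>2 \<le> (norm (w - x))\<^sup>2"
  proof -
    have "(norm (w - u))\<^sup>2 = 2 - 2 * (w \<bullet> u)" using sq[of 1] by simp
    moreover have "(norm (w - x))\<^sup>2 = 1 + r\<^sup>2 - 2 * r * (w \<bullet> u)" using sq[of r] by (simp add: x)
    moreover have "2 * r \<le> 1 + r\<^sup>2"
      using zero_le_power2[of "r - 1"] by (simp add: power2_eq_square algebra_simps)
    ultimately show ?thesis by (simp only: right_diff_distrib)
  qed
  then have "norm (w - u) ^ 2 \<le> (norm (w - x) / sqrt r) ^ 2"
    using r by (simp add: power_divide field_simps)
  then show ?thesis
    unfolding u_def r_def by (rule power2_le_imp_le) (auto intro: divide_nonneg_nonneg)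
qed

text \<open>
Enumerating the zeros as \<open>z 0, \<dots>, z (n - 1)\<close> with repetitions turns the multiset of zeros into
a finite index set, so that sums and products over zeros are ordinary ones.
\<close>
locale factored_poly =
  fixes p :: "complex poly" and n :: nat and z :: "nat \<Rightarrow> complex"
  assumes decomp: "p = smult (lead_coeff p) (\<Prod>i<n. [:- z i, 1:])"
    and degree: "degree p = n"
    and coeff_0: "coeff p 0 \<noteq> 0"
begin

abbreviation S :: real where "S \<equiv> (\<Sum>k\<le>n. norm (coeff p k))"

lemma lead_pos: "norm (lead_coeff p) > 0"
  using coeff_0 by auto

lemma poly_eq_prod: "poly p w = lead_coeff p * (\<Prod>i<n. w - z i)"
  by (subst decomp) (simp add: poly_prod)

lemma coeff_0_eq: "norm (coeff p 0) = norm (lead_coeff p) * (\<Prod>i<n. norm (z i))"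
  using poly_eq_prod[of 0] by (simp add: poly_0_coeff_0 norm_mult prod_norm[symmetric] del: prod_norm)

lemma root_nonzero: "i < n \<Longrightarrow> z i \<noteq> 0"
  using coeff_0_eq coeff_0 by (metis finite_lessThan lessThan_iff mult_zero_right norm_eq_zero prod_zero_iff)

lemma S_pos: "S > 0"
proof -
  have "norm (coeff p 0) \<le> S"
    by (rule member_le_sum) auto
  with coeff_0 show ?thesis by (meson less_le_trans zero_less_norm_iff)
qed

lemma poly_log_ratio_eq:
  "poly_log_ratio p = ln S - ln (norm (lead_coeff p)) - (\<Sum>i<n. ln (norm (z i))) / 2"
proof -
  have "ln (\<Prod>i<n. norm (z i)) = (\<Sum>i<n. ln (norm (z i)))"
    using root_nonzero by (intro ln_prod) auto
  moreover have "(\<Prod>i<n. norm (z i)) > 0"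
    using root_nonzero by (intro prod_pos) auto
  ultimately have "ln (norm (coeff p 0)) = ln (norm (lead_coeff p)) + (\<Sum>i<n. ln (norm (z i)))"
    unfolding coeff_0_eq using lead_pos by (simp only: ln_mult_pos)
  then show ?thesis unfolding poly_log_ratio_def degree by (simp add: field_simps)
qed

text \<open>
Jensen's inequality without integrals.  Replacing each factor \<open>w - z i\<close> with a zero inside the
disc by the reflected factor \<open>1 - cnj (z i) * w\<close> leaves the modulus on the unit circle unchanged
and pushes all zeros out of the open disc; the maximum principle at the origin then bounds the
product of \<open>max 1 (norm (z i))\<close>, i.e. the Mahler measure, by the sum of the moduli of the
coefficients.  Combined with the formula for the constant coefficient this controls the logarithms
of both signs.
\<close>
lemma sum_abs_ln_norm_roots_le: "(\<Sum>i<n. \<bar>ln (norm (z i))\<bar>) \<le> 2 * poly_log_ratio p"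
proof -
  define R where "R = smult (lead_coeff p)
      (\<Prod>i<n. if norm (z i) < 1 then [:1, - cnj (z i):] else [:- z i, 1:])"
  have norm_poly_R: "norm (poly R w) = norm (lead_coeff p) *
      (\<Prod>i<n. norm (poly (if norm (z i) < 1 then [:1, - cnj (z i):] else [:- z i, 1:]) w))" for w
    by (simp only: R_def poly_smult poly_prod norm_mult prod_norm)
  have "norm (poly R w) \<le> S" if w: "norm w = 1" for w
  proof -
    have reflect: "norm (1 - w * cnj (z i)) = norm (w - z i)" for i
    proof -
      have "w * cnj w = 1" using w by (simp add: complex_norm_square[symmetric])
      then have "1 - w * cnj (z i) = w * cnj (w - z i)" by (simp add: algebra_simps)
      then show ?thesis using w by (simp only: norm_mult complex_mod_cnj mult_1)
    qed
    have "norm (poly R w) = norm (lead_coeff p) * (\<Prod>i<n. norm (w - z i))"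
      unfolding norm_poly_R by (intro arg_cong2[of _ _ _ _ "(*)"] prod.cong) (auto simp: reflect)
    also have "\<dots> = norm (poly p w)"
      by (simp add: poly_eq_prod norm_mult prod_norm)
    also have "\<dots> \<le> S"
      using norm_poly_le_sum_norm_coeff[OF w, of p] by (simp add: degree)
    finally show ?thesis .
  qed
  then have "norm (poly R 0) \<le> S"
    by (rule poly_max_modulus) auto
  also have "norm (poly R 0) = norm (lead_coeff p) * (\<Prod>i<n. max 1 (norm (z i)))"
    unfolding norm_poly_R by (intro arg_cong2[of _ _ _ _ "(*)"] prod.cong) auto
  finally have R0: "norm (lead_coeff p) * (\<Prod>i<n. max 1 (norm (z i))) \<le> S" .
  have max_pos: "(\<Prod>i<n. max 1 (norm (z i))) > 0"
    by (intro prod_pos) (auto simp: less_max_iff_disj)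
  from R0 have "ln (norm (lead_coeff p) * (\<Prod>i<n. max 1 (norm (z i)))) \<le> ln S"
    using mult_pos_pos[OF lead_pos max_pos] S_pos by (simp only: ln_le_cancel_iff)
  moreover have "ln (norm (lead_coeff p) * (\<Prod>i<n. max 1 (norm (z i))))
      = ln (norm (lead_coeff p)) + ln (\<Prod>i<n. max 1 (norm (z i)))"
    using lead_pos max_pos by (rule ln_mult_pos)
  moreover have "ln (\<Prod>i<n. max 1 (norm (z i))) = (\<Sum>i<n. ln (max 1 (norm (z i))))"
    by (rule ln_prod) (auto simp: max_def)
  ultimately have le: "(\<Sum>i<n. ln (max 1 (norm (z i)))) \<le> ln S - ln (norm (lead_coeff p))" by linarith
  have "\<bar>ln (norm (z i))\<bar> = 2 * ln (max 1 (norm (z i))) - ln (norm (z i))" if "i < n" for i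
    using root_nonzero[OF that] by (auto simp: max_def abs_if)
  then have "(\<Sum>i<n. \<bar>ln (norm (z i))\<bar>)
      = 2 * (\<Sum>i<n. ln (max 1 (norm (z i)))) - (\<Sum>i<n. ln (norm (z i)))"
    by (simp add: sum_subtractf sum_distrib_left)
  with le show ?thesis by (simp add: poly_log_ratio_eq)
qed

lemma poly_log_ratio_nonneg: "poly_log_ratio p \<ge> 0"
  using order_trans[OF _ sum_abs_ln_norm_roots_le, of 0] by (simp add: sum_nonneg)

text \<open>
The factors \<open>1 / sqrt (norm (z i))\<close> lost in projecting the zeros multiply to the square root of
\<open>norm (lead_coeff p) / norm (coeff p 0)\<close>.  This is why \<open>L\<close> weights both extreme coefficients with
one half.
\<close>
lemma norm_prod_sgn_roots_le:
  assumes w: "norm w = 1"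
  shows "norm (\<Prod>i<n. w - sgn (z i)) \<le> exp (poly_log_ratio p)"
proof -
  have "norm (\<Prod>i<n. w - sgn (z i)) \<le> (\<Prod>i<n. norm (w - z i) / sqrt (norm (z i)))"
    unfolding prod_norm[symmetric]
    by (intro prod_mono) (auto intro!: norm_diff_sgn_le w root_nonzero)
  also have "\<dots> = (\<Prod>i<n. norm (w - z i)) / (\<Prod>i<n. sqrt (norm (z i)))"
    by (rule prod_dividef)
  also have "(\<Prod>i<n. norm (w - z i)) \<le> S / norm (lead_coeff p)"
    using norm_poly_le_sum_norm_coeff[OF w, of p] lead_pos
    by (simp add: degree poly_eq_prod norm_mult prod_norm field_simps)
  also have "S / norm (lead_coeff p) / (\<Prod>i<n. sqrt (norm (z i))) = exp (poly_log_ratio p)"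
  proof -
    have "(\<Prod>i<n. sqrt (norm (z i))) = exp ((\<Sum>i<n. ln (norm (z i))) / 2)"
      using root_nonzero
      by (auto simp: exp_sum sum_divide_distrib ln_sqrt[symmetric] intro!: prod.cong)
    then show ?thesis using S_pos lead_pos
      by (simp add: poly_log_ratio_eq exp_diff)
  qed
  finally show ?thesis by (simp add: divide_right_mono prod_nonneg)
qed

end

section \<open>Power sums of points on the unit circle\<close>

lemma prod_diff_roots_of_unity:
  fixes w y :: complex
  assumes k: "k \<ge> 1"
  shows "(\<Prod>\<zeta> | \<zeta> ^ k = 1. w - \<zeta> * y) = w ^ k - y ^ k"
proof (cases "y = 0")
  case True
  then show ?thesis using k card_complex_roots_unity[OF k] by (simp add: power_0_left)
next
  case False
  let ?U = "{\<zeta>::complex. \<zeta> ^ k = 1}"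
  have fin: "finite ?U" and card: "card ?U = k"
    using k finite_roots_unity card_complex_roots_unity by auto
  define A where "A = (\<Prod>\<zeta>\<in>?U. [:- (\<zeta> * y), 1:])"
  define B where "B = monom 1 k - [:y ^ k:]"
  have degA: "degree A = k" unfolding A_def by (simp add: degree_prod_sum_eq card)
  have lcA: "lead_coeff A = 1" unfolding A_def by (simp add: lead_coeff_prod)
  have degB: "degree B = k"
    using k unfolding B_def diff_conv_add_uminus
    by (subst degree_add_eq_left) (auto simp: degree_monom_eq)
  have lcB: "lead_coeff B = 1"
    unfolding degB using k by (simp add: B_def coeff_pCons split: nat.split)
  have "A = B"
  proof (rule ccontr)
    assume "A \<noteq> B"
    then have ne: "A - B \<noteq> 0" by simp
    have "degree (A - B) \<le> k" by (rule degree_diff_le) (simp_all add: degA degB)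
    moreover have "coeff (A - B) k = 0" using lcA lcB by (simp add: degA degB)
    ultimately have deg: "degree (A - B) < k"
      using ne by (metis le_neq_implies_less leading_coeff_0_iff)
    have "(\<lambda>\<zeta>. \<zeta> * y) ` ?U \<subseteq> {x. poly (A - B) x = 0}"
    proof safe
      fix \<zeta> :: complex assume \<zeta>: "\<zeta> ^ k = 1"
      have "poly A (\<zeta> * y) = 0" using fin \<zeta> by (auto simp: A_def poly_prod)
      moreover have "poly B (\<zeta> * y) = 0" using \<zeta> by (simp add: B_def poly_monom power_mult_distrib)
      ultimately show "poly (A - B) (\<zeta> * y) = 0" by simp
    qed
    then have "card ((\<lambda>\<zeta>. \<zeta> * y) ` ?U) \<le> card {x. poly (A - B) x = 0}"
      by (intro card_mono poly_roots_finite ne)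
    also have "\<dots> \<le> degree (A - B)" by (rule card_poly_roots_bound[OF ne])
    finally have "k \<le> degree (A - B)"
      using False card by (subst (asm) card_image) (auto simp: inj_on_def)
    with deg show False by simp
  qed
  then have "poly A w = poly B w" by simp
  then show ?thesis by (simp add: A_def B_def poly_prod poly_monom)
qed

text \<open>
A Borel--Caratheodory estimate for the first Taylor coefficient.  The function
\<open>f w = (\<Sum>i<n. Ln (1 - c i * w))\<close> vanishes at the origin, has derivative \<open>- (\<Sum>i<n. c i)\<close> there, and its
real part is the logarithm of the modulus of the product, hence below any \<open>A > B\<close> in the disc.
The map \<open>s \<mapsto> s / (2 * A - s)\<close> sends the half plane \<open>Re s < A\<close> into the unit disc and fixes
\<open>0\<close>, so Schwarz's lemma applies to the composition.
\<close>
lemma norm_sum_le_of_norm_prod_le: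
  fixes c :: "nat \<Rightarrow> complex"
  assumes c: "\<And>i. i < n \<Longrightarrow> norm (c i) = 1"
    and bound: "\<And>w. norm w = 1 \<Longrightarrow> norm (\<Prod>i<n. 1 - c i * w) \<le> exp B"
    and B: "B \<ge> 0"
  shows "norm (\<Sum>i<n. c i) \<le> 2 * B"
proof -
  have gt: "norm (\<Sum>i<n. c i) \<le> 2 * A" if A: "A > B" for A
  proof -
    have A0: "A > 0" using A B by simp
    define f where "f = (\<lambda>w. \<Sum>i<n. Ln (1 - c i * w))"
    define g where "g = (\<lambda>w. f w / (of_real (2 * A) - f w))"
    have half_plane: "Re (1 - c i * w) > 0" if "norm w < 1" "i < n" for w i
    proof -
      have "Re (c i * w) \<le> norm (c i * w)" by (rule complex_Re_le_cmod)
      also have "\<dots> < 1" using that c by (simp add: norm_mult)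
      finally show ?thesis by simp
    qed
    then have slit: "1 - c i * w \<notin> \<real>\<^sub>\<le>\<^sub>0" if "norm w < 1" "i < n" for w i
      using that by (meson complex_nonpos_Reals_iff not_le)
    have Re_f: "Re (f w) < A" if w: "norm w < 1" for w
    proof -
      have "exp (f w) = (\<Prod>i<n. exp (Ln (1 - c i * w)))" by (simp add: f_def exp_sum)
      also have "\<dots> = (\<Prod>i<n. 1 - c i * w)"
        using slit[OF w] by (intro prod.cong refl exp_Ln) fastforce
      also have "\<dots> = poly (\<Prod>i<n. [:1, - c i:]) w" by (simp add: poly_prod mult.commute)
      finally have "exp (Re (f w)) = norm (poly (\<Prod>i<n. [:1, - c i:]) w)"
        by (metis norm_exp_eq_Re)
      also have "\<dots> \<le> exp B"
      proof (rule poly_max_modulus)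
        fix v :: complex assume "norm v = 1"
        then show "norm (poly (\<Prod>i<n. [:1, - c i:]) v) \<le> exp B"
          using bound[of v] by (simp add: poly_prod mult.commute)
      qed (use w in simp)
      finally show ?thesis using A by simp
    qed
    have f0: "f 0 = 0" by (simp add: f_def)
    have denom: "of_real (2 * A) - f w \<noteq> 0" if "norm w < 1" for w
    proof
      assume "of_real (2 * A) - f w = 0"
      then have "Re (f w) = 2 * A" by (simp add: complex_eq_iff)
      with Re_f[OF that] A0 show False by simp
    qed
    have holf: "f holomorphic_on ball 0 1"
      unfolding f_def by (intro holomorphic_intros) (use slit in auto)
    have "norm (deriv g 0) \<le> 1"
    proof (rule Schwarz_Lemma(2))
      show "g holomorphic_on ball 0 1"
        unfolding g_def by (intro holomorphic_intros holf) (use denom in auto)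
      show "g 0 = 0" by (simp add: g_def f0)
      show "norm (0::complex) < 1" by simp
      fix w :: complex assume w: "norm w < 1"
      have "(norm (f w))\<^sup>2 < (norm (of_real (2 * A) - f w))\<^sup>2"
        using mult_strict_left_mono[OF Re_f[OF w], of "4 * A"] A0
        unfolding cmod_power2 by (simp add: power2_eq_square algebra_simps)
      then have "norm (f w) < norm (of_real (2 * A) - f w)"
        by (rule power2_less_imp_less) simp
      then show "norm (g w) < 1"
        using denom[OF w] by (simp add: g_def norm_divide divide_less_eq)
    qed
    moreover have "(g has_field_derivative (- (\<Sum>i<n. c i)) / of_real (2 * A)) (at 0)"
    proof -
      have "(f has_field_derivative (\<Sum>i<n. - c i)) (at 0)"
        unfolding f_def by (rule DERIV_sum) (auto intro!: derivative_eq_intros)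
      then show ?thesis
        unfolding g_def using A0 by (auto intro!: derivative_eq_intros simp: f0 sum_negf field_simps)
    qed
    then have "deriv g 0 = (- (\<Sum>i<n. c i)) / of_real (2 * A)"
      by (rule DERIV_imp_deriv)
    ultimately show ?thesis using A0 by (simp add: norm_divide divide_le_eq)
  qed
  show ?thesis
  proof (rule field_le_epsilon)
    fix e :: real assume "e > 0"
    then show "norm (\<Sum>i<n. c i) \<le> 2 * B + e" using gt[of "B + e / 2"] by simp
  qed
qed

text \<open>
For the \<open>k\<close>-th power sum the first-coefficient estimate is applied to the points \<open>u i ^ k\<close>.  The
required bound comes from averaging over rotations: \<open>w ^ k - u ^ k\<close> is the product of
\<open>w - \<zeta> * u\<close> over the \<open>k\<close>-th roots of unity \<open>\<zeta>\<close>, so the new product is a product of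
\<open>k\<close> rotated copies of the old one and is at most \<open>exp (k * B)\<close>.
\<close>
lemma norm_power_sum_le_of_norm_prod_le:
  fixes u :: "nat \<Rightarrow> complex"
  assumes u: "\<And>i. i < n \<Longrightarrow> norm (u i) = 1"
    and bound: "\<And>w. norm w = 1 \<Longrightarrow> norm (\<Prod>i<n. w - u i) \<le> exp B"
    and B: "B \<ge> 0" and k: "k \<ge> 1"
  shows "norm (\<Sum>i<n. u i ^ k) \<le> 2 * (real k * B)"
proof -
  let ?U = "{\<zeta>::complex. \<zeta> ^ k = 1}"
  have "norm (\<Sum>i<n. cnj (u i ^ k)) \<le> 2 * (real k * B)"
  proof (rule norm_sum_le_of_norm_prod_le)
    show "norm (cnj (u i ^ k)) = 1" if "i < n" for i
      using u[OF that] by (simp add: norm_power)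
    show "real k * B \<ge> 0" using B by simp
    fix w :: complex assume w: "norm w = 1"
    \<comment> \<open>a \<open>k\<close>-th root of \<open>w\<close>, so that \<open>prod_diff_roots_of_unity\<close> factors \<open>w - u i ^ k\<close>\<close>
    define v where "v = cis (Arg w / real k)"
    have "w \<noteq> 0" using w by auto
    then have "v ^ k = sgn w" using k by (simp add: v_def Complex.DeMoivre cis_Arg)
    then have v: "norm v = 1" "v ^ k = w" using w by (simp_all add: v_def sgn_eq)
    have \<zeta>: "norm \<zeta> = 1" if "\<zeta> ^ k = 1" for \<zeta> :: complex
      using that k by (metis One_nat_def norm_ge_zero norm_one norm_power power_eq_1_iff not_one_le_zero)
    have reflect: "norm (1 - cnj (u i ^ k) * w) = norm (v ^ k - u i ^ k)" if "i < n" for i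
    proof -
      have "u i * cnj (u i) = 1" using u[OF that] by (simp add: complex_norm_square[symmetric])
      then have "u i ^ k * cnj (u i ^ k) = 1" by (simp add: power_mult_distrib[symmetric])
      then have "u i ^ k * (1 - cnj (u i ^ k) * w) = u i ^ k - w" by (simp add: algebra_simps)
      then have "norm (u i ^ k) * norm (1 - cnj (u i ^ k) * w) = norm (u i ^ k - w)"
        by (metis norm_mult)
      then show ?thesis using u[OF that] by (simp add: norm_power v norm_minus_commute)
    qed
    have "norm (\<Prod>i<n. 1 - cnj (u i ^ k) * w) = (\<Prod>i<n. norm (v ^ k - u i ^ k))"
      unfolding prod_norm[symmetric] by (intro prod.cong refl reflect) simp
    also have "\<dots> = (\<Prod>i<n. \<Prod>\<zeta>\<in>?U. norm (v - \<zeta> * u i))"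
      unfolding prod_norm by (simp only: prod_diff_roots_of_unity[OF k])
    also have "\<dots> = (\<Prod>\<zeta>\<in>?U. \<Prod>i<n. norm (v - \<zeta> * u i))" by (rule prod.swap)
    also have "\<dots> \<le> (\<Prod>\<zeta>\<in>?U. exp B)"
    proof (intro prod_mono conjI prod_nonneg norm_ge_zero)
      fix \<zeta> assume "\<zeta> \<in> ?U"
      then have n1: "norm \<zeta> = 1" using \<zeta> by simp
      then have "v - \<zeta> * x = \<zeta> * (v / \<zeta> - x)" for x by (cases "\<zeta> = 0") (auto simp: field_simps)
      then have "norm (v - \<zeta> * x) = norm (v / \<zeta> - x)" for x using n1 by (metis mult_1 norm_mult)
      then have "(\<Prod>i<n. norm (v - \<zeta> * u i)) = norm (\<Prod>i<n. v / \<zeta> - u i)"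
        by (simp add: prod_norm)
      also have "\<dots> \<le> exp B" using v n1 by (intro bound) (simp add: norm_divide)
      finally show "(\<Prod>i<n. norm (v - \<zeta> * u i)) \<le> exp B" .
    qed
    also have "\<dots> = exp (real k * B)"
      using card_complex_roots_unity[OF k] by (simp add: exp_of_nat_mult)
    finally show "norm (\<Prod>i<n. 1 - cnj (u i ^ k) * w) \<le> exp (real k * B)" .
  qed
  also have "(\<Sum>i<n. cnj (u i ^ k)) = cnj (\<Sum>i<n. u i ^ k)" by simp
  finally show ?thesis by (simp only: complex_mod_cnj)
qed

lemma size_filter_proots_eq_card:
  fixes p :: "complex poly" and n :: nat
  assumes "p = smult c (\<Prod>i<n. [:- z i, 1:])" "c \<noteq> 0"
  shows "size (filter_mset P (proots p)) = card {i. i < n \<and> P (z i)}"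
proof -
  have "proots p = proots (\<Prod>i<n. [:- z i, 1:])"
    using assms by simp
  also have "\<dots> = (\<Sum>i<n. {#z i#})" by (subst proots_prod) auto
  finally have "size (filter_mset P (proots p)) = size (filter_mset P (\<Sum>i<n. {#z i#}))" by simp
  also have "\<dots> = (\<Sum>i<n. if P (z i) then 1 else 0)"
    by (induction n) auto
  also have "\<dots> = card {i. i < n \<and> P (z i)}"
    by (simp add: sum.If_cases Int_def)
  finally show ?thesis .
qed

context factored_poly begin

lemma norm_power_sum_sgn_roots_le:
  assumes "k \<ge> 1"
  shows "norm (\<Sum>i<n. sgn (z i) ^ k) \<le> 2 * (real k * poly_log_ratio p)"
  using root_nonzero poly_log_ratio_nonneg assms norm_prod_sgn_roots_le
  by (intro norm_power_sum_le_of_norm_prod_le) (auto simp: norm_sgn)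

lemma card_roots_eq_size_filter_proots:
  "card {i. i < n \<and> P (z i)} = size (filter_mset P (proots p))"
  by (rule size_filter_proots_eq_card[OF decomp, symmetric]) (use coeff_0 in auto)

text \<open>
Every zero outside the annulus contributes at least \<open>\<rho>\<close> to the sum in Jensen's inequality, since
\<open>ln x \<le> x - 1\<close>.
\<close>
lemma annulus_count_ge:
  assumes \<rho>: "0 < \<rho>" "\<rho> \<le> 1"
  shows "real n - real (annulus_count p \<rho>) \<le> 2 * poly_log_ratio p / \<rho>"
proof -
  let ?P = "\<lambda>x::complex. 1 - \<rho> \<le> norm x \<and> (\<rho> = 1 \<or> norm x \<le> 1 / (1 - \<rho>))"
  let ?G = "{i. i < n \<and> ?P (z i)}"
  let ?E = "{..<n} - ?G"
  have "real n - real (annulus_count p \<rho>) = real (card ?E)"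
  proof -
    have "annulus_count p \<rho> = card ?G"
      unfolding annulus_count_def by (rule card_roots_eq_size_filter_proots[symmetric])
    moreover have "card ?E = n - card ?G" by (subst card_Diff_subset) auto
    moreover have "card ?G \<le> n" using card_mono[of "{..<n}" ?G] by auto
    ultimately show ?thesis by simp
  qed
  moreover have "\<rho> * real (card ?E) \<le> (\<Sum>i\<in>?E. \<bar>ln (norm (z i))\<bar>)"
  proof -
    have "\<rho> \<le> \<bar>ln (norm (z i))\<bar>" if "i \<in> ?E" for i
    proof -
      have i: "i < n" and out: "norm (z i) < 1 - \<rho> \<or> \<rho> \<noteq> 1 \<and> norm (z i) > 1 / (1 - \<rho>)"
        using that by auto
      have pos: "norm (z i) > 0" using root_nonzero[OF i] by simp
      from out show ?thesis
      proof
        assume "norm (z i) < 1 - \<rho>"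
        moreover have "ln (norm (z i)) \<le> norm (z i) - 1" using pos by (rule ln_le_minus_one)
        ultimately show ?thesis by linarith
      next
        assume *: "\<rho> \<noteq> 1 \<and> norm (z i) > 1 / (1 - \<rho>)"
        then have "1 - \<rho> > 0" "1 / (1 - \<rho>) < norm (z i)" using \<rho> by auto
        then have "1 / norm (z i) < 1 - \<rho>" using pos by (simp add: field_simps)
        moreover have "ln (1 / norm (z i)) \<le> 1 / norm (z i) - 1" using pos by (intro ln_le_minus_one) simp
        moreover have "ln (1 / norm (z i)) = - ln (norm (z i))" using pos by (simp add: ln_div)
        ultimately show ?thesis by linarith
      qed
    qed
    then have "(\<Sum>i\<in>?E. \<rho>) \<le> (\<Sum>i\<in>?E. \<bar>ln (norm (z i))\<bar>)" by (rule sum_mono)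
    then show ?thesis by (simp add: mult.commute)
  qed
  moreover have "(\<Sum>i\<in>?E. \<bar>ln (norm (z i))\<bar>) \<le> (\<Sum>i<n. \<bar>ln (norm (z i))\<bar>)"
    by (rule sum_mono2) auto
  ultimately show ?thesis
    using sum_abs_ln_norm_roots_le \<rho> by (simp add: field_simps)
qed

end

section \<open>Equidistribution from bounds on the power sums\<close>

text \<open>
A quantitative form of Weyl's criterion for the angles \<open>t 0, \<dots>, t (n - 1)\<close>: the linear growth in
\<open>k\<close> is what the power sums of projected zeros satisfy with \<open>B = 2 * L\<close>.
\<close>
definition power_sums_bounded :: "nat \<Rightarrow> (nat \<Rightarrow> real) \<Rightarrow> real \<Rightarrow> bool" where
  "power_sums_bounded n t B \<longleftrightarrow> (\<forall>k\<ge>1. norm (\<Sum>i<n. cis (real k * t i)) \<le> real k * B)"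

text \<open>
Trigonometric polynomials as functions of the angle.  In this form products of characters are
again characters without any side condition, so closure under multiplication is a plain induction.
\<close>
inductive trig_poly :: "(real \<Rightarrow> complex) \<Rightarrow> bool" where
  mono: "trig_poly (\<lambda>t. c * cis (of_int k * t))"
| add: "trig_poly f \<Longrightarrow> trig_poly g \<Longrightarrow> trig_poly (\<lambda>t. f t + g t)"

lemma trig_poly_const: "trig_poly (\<lambda>_. c)"
  using trig_poly.mono[of c 0] by simp

lemma trig_poly_mult_mono:
  "trig_poly g \<Longrightarrow> trig_poly (\<lambda>t. c * cis (of_int k * t) * g t)"
proof (induction rule: trig_poly.induct)
  case (mono d l)
  have "c * cis (of_int k * t) * (d * cis (of_int l * t)) = c * d * cis (of_int (k + l) * t)" for t
  proof -
    have "cis (of_int (k + l) * t) = cis (of_int k * t) * cis (of_int l * t)"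
      by (simp add: cis_mult distrib_right)
    then show ?thesis by (simp only: mult_ac)
  qed
  then show ?case by (simp only: trig_poly.mono)
qed (auto simp: distrib_left intro: trig_poly.add)

lemma trig_poly_mult: "trig_poly f \<Longrightarrow> trig_poly g \<Longrightarrow> trig_poly (\<lambda>t. f t * g t)"
  by (induction rule: trig_poly.induct)
     (auto simp: distrib_right trig_poly_mult_mono intro: trig_poly.add)

text \<open>
On the circle every real linear functional is a combination of \<open>cis t\<close> and \<open>cis (- t)\<close>, so
the restrictions of real polynomial functions of the plane are trigonometric polynomials.  This lets
the Stone--Weierstrass theorem for real polynomial functions supply trigonometric approximations.
\<close>
lemma trig_poly_real_polynomial_on_circle:
  "real_polynomial_function f \<Longrightarrow> trig_poly (\<lambda>t. of_real (f (cis t)))"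
proof (induction rule: real_polynomial_function.induct)
  case (linear f)
  interpret f: bounded_linear f by fact
  have "of_real (f (cis t)) = (Complex (f 1) (- f \<i>) / 2) * cis (of_int 1 * t)
      + (Complex (f 1) (f \<i>) / 2) * cis (of_int (- 1) * t)" for t
  proof -
    have "cis t = cos t *\<^sub>R 1 + sin t *\<^sub>R \<i>" by (simp add: complex_eq_iff)
    then have "f (cis t) = cos t * f 1 + sin t * f \<i>" by (simp only: f.add f.scaleR real_scaleR_def)
    then show ?thesis by (simp add: complex_eq_iff field_simps)
  qed
  then show ?case by (simp only:) (intro trig_poly.intros)
qed (auto intro: trig_poly_const trig_poly.add trig_poly_mult)

text \<open>
Here \<open>c\<close> is the mean of \<open>f\<close> over a period, i.e. its constant Fourier coefficient.  The other
characters integrate to zero, and their sums over the given angles are bounded by hypothesis, the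
negative frequencies by conjugation; so \<open>C\<close> can be taken as the sum of \<open>norm (c k) * \<bar>k\<bar>\<close> over
the Fourier coefficients, which depends on \<open>f\<close> alone.
\<close>
lemma trig_poly_equidistribution:
  "trig_poly f \<Longrightarrow> \<exists>c C. (f has_integral of_real (2 * pi) * c) {0..2 * pi} \<and>
     (\<forall>n (t :: nat \<Rightarrow> real) B. power_sums_bounded n t B \<longrightarrow>
        norm ((\<Sum>i<n. f (t i)) - of_nat n * c) \<le> C * B)"
proof (induction rule: trig_poly.induct)
  case (mono c k)
  show ?case
  proof (cases "k = 0")
    case True
    have "((\<lambda>_. c) has_integral (2 * pi - 0) *\<^sub>R c) {0..2 * pi}"
      using has_integral_const_real[of c 0 "2 * pi"] by simp
    then show ?thesis using True
      by (intro exI[of _ c] exI[of _ 0]) (auto simp: scaleR_conv_of_real)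
  next
    case False
    define F where "F = (\<lambda>t. c / (\<i> * of_int k) * cis (of_int k * t))"
    have "((\<lambda>t. c * cis (of_int k * t)) has_integral F (2 * pi) - F 0) {0..2 * pi}"
    proof (rule fundamental_theorem_of_calculus)
      fix t assume "t \<in> {0..2 * pi}"
      have "((\<lambda>t. cis (of_int k * t)) has_vector_derivative of_int k *\<^sub>R (\<i> * cis (of_int k * t))) (at t within {0..2 * pi})"
        unfolding has_vector_derivative_def
        by (rule derivative_eq_intros refl)+ (auto simp: fun_eq_iff mult.commute)
      then have "(F has_vector_derivative c / (\<i> * of_int k) * (of_int k *\<^sub>R (\<i> * cis (of_int k * t)))) (at t within {0..2 * pi})"
        unfolding F_def by (rule has_vector_derivative_mult_right)
      then show "(F has_vector_derivative c * cis (of_int k * t)) (at t within {0..2 * pi})"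
        using False by (simp add: scaleR_conv_of_real field_simps)
    qed simp
    moreover have "F (2 * pi) = F 0"
      using cis_multiple_2pi[of "of_int k"] by (simp add: F_def mult.commute mult.left_commute)
    ultimately have int: "((\<lambda>t. c * cis (of_int k * t)) has_integral of_real (2 * pi) * 0) {0..2 * pi}" by simp
    have "norm ((\<Sum>i<n. c * cis (of_int k * t i)) - of_nat n * 0) \<le> norm c * \<bar>of_int k\<bar> * B"
      if H: "power_sums_bounded n t B" for n B and t :: "nat \<Rightarrow> real"
    proof -
      define m where "m = nat \<bar>k\<bar>"
      have m: "m \<ge> 1" "real m = \<bar>of_int k\<bar>" using False by (auto simp: m_def)
      have "norm (\<Sum>i<n. cis (of_int k * t i)) = norm (\<Sum>i<n. cis (real m * t i))"
      proof (cases "k > 0")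
        case True then show ?thesis using m by simp
      next
        case False
        then have "(\<Sum>i<n. cis (of_int k * t i)) = cnj (\<Sum>i<n. cis (real m * t i))"
          using m by (simp add: cis_cnj)
        then show ?thesis by (simp only: complex_mod_cnj)
      qed
      also have "\<dots> \<le> \<bar>of_int k\<bar> * B" using H m unfolding power_sums_bounded_def by metis
      finally show ?thesis
        by (simp add: sum_distrib_left[symmetric] norm_mult mult.assoc mult_left_mono)
    qed
    with int show ?thesis by blast
  qed
next
  case (add f g)
  then obtain c C d D where
    c: "(f has_integral of_real (2 * pi) * c) {0..2 * pi}"
      "\<And>n (t :: nat \<Rightarrow> real) B. power_sums_bounded n t B \<Longrightarrow>
        norm ((\<Sum>i<n. f (t i)) - of_nat n * c) \<le> C * B" and
    d: "(g has_integral of_real (2 * pi) * d) {0..2 * pi}"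
      "\<And>n (t :: nat \<Rightarrow> real) B. power_sums_bounded n t B \<Longrightarrow>
        norm ((\<Sum>i<n. g (t i)) - of_nat n * d) \<le> D * B"
    by metis
  have "norm ((\<Sum>i<n. f (t i) + g (t i)) - of_nat n * (c + d)) \<le> (C + D) * B"
    if H: "power_sums_bounded n t B" for n B and t :: "nat \<Rightarrow> real"
  proof -
    have "(\<Sum>i<n. f (t i) + g (t i)) - of_nat n * (c + d)
        = ((\<Sum>i<n. f (t i)) - of_nat n * c) + ((\<Sum>i<n. g (t i)) - of_nat n * d)"
      by (simp add: sum.distrib algebra_simps)
    then show ?thesis using norm_triangle_mono[OF c(2)[OF H] d(2)[OF H]]
      by (simp only: distrib_right)
  qed
  moreover have "((\<lambda>t. f t + g t) has_integral of_real (2 * pi) * (c + d)) {0..2 * pi}"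
    using has_integral_add[OF c(1) d(1)] by (simp add: distrib_left)
  ultimately show ?case by blast
qed

text \<open>
A tent function: continuous, equal to one on \<open>A\<close>, and decreasing to the indicator of \<open>A\<close>, for
closed nonempty \<open>A\<close>, as \<open>m\<close> grows.
\<close>
definition arc_majorant :: "complex set \<Rightarrow> nat \<Rightarrow> complex \<Rightarrow> real" where
  "arc_majorant A m x = max 0 (1 - real m * infdist x A)"

lemma arc_majorant_bounds: "0 \<le> arc_majorant A m x" "arc_majorant A m x \<le> 1"
  by (auto simp: arc_majorant_def infdist_nonneg)

lemma arc_majorant_eq_1: "x \<in> A \<Longrightarrow> arc_majorant A m x = 1"
  by (simp add: arc_majorant_def)

lemma continuous_on_arc_majorant: "continuous_on S (arc_majorant A m)"
  unfolding arc_majorant_def by (intro continuous_intros)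

text \<open>
Parametrising the circle by \<open>{0..2 * pi}\<close> identifies only the endpoints, a null set that does not
affect integrals.
\<close>
lemma cis_eq_imp_endpoint:
  assumes "cis t = cis s" "0 \<le> t" "t \<le> 2 * pi" "0 \<le> s" "s \<le> 2 * pi" "t \<noteq> s"
  shows "t \<in> {0, 2 * pi}"
proof -
  have "sin t = sin s \<and> cos t = cos s" using assms(1) by (simp add: complex_eq_iff)
  then obtain m :: int where m: "t = s + 2 * pi * of_int m" using sin_cos_eq_iff[of t s] by blast
  have "m \<noteq> 0" using m assms by auto
  show ?thesis
  proof (cases "m \<ge> 1")
    case True
    then have "2 * pi * 1 \<le> 2 * pi * real_of_int m" by (intro mult_left_mono) auto
    with m assms have "t = 2 * pi" by linarith
    then show ?thesis by simp
  next
    case False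
    with \<open>m \<noteq> 0\<close> have "real_of_int m \<le> -1" by (simp flip: of_int_le_iff)
    then have "2 * pi * real_of_int m \<le> 2 * pi * (- 1)" by (intro mult_left_mono) auto
    with m assms have "t = 0" by linarith
    then show ?thesis by simp
  qed
qed

lemma integral_arc_majorant_tendsto:
  assumes "0 \<le> \<theta>" "\<theta> \<le> \<phi>" "\<phi> \<le> 2 * pi"
  shows "(\<lambda>m. integral {0..2 * pi} (\<lambda>t. arc_majorant (cis ` {\<theta>..\<phi>}) m (cis t))) \<longlonglongrightarrow> \<phi> - \<theta>"
proof -
  let ?A = "cis ` {\<theta>..\<phi>}"
  let ?I = "\<lambda>t. if cis t \<in> ?A then 1 else 0 :: real"
  have clA: "closed ?A" "?A \<noteq> {}"
    using assms by (auto intro!: compact_imp_closed compact_continuous_image continuous_intros)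
  have lim: "(\<lambda>m. integral {0..2 * pi} (\<lambda>t. arc_majorant ?A m (cis t))) \<longlonglongrightarrow> integral {0..2 * pi} ?I"
  proof (rule dominated_convergence(2)[where h = "\<lambda>_. 1"])
    show "(\<lambda>t. arc_majorant ?A m (cis t)) integrable_on {0..2 * pi}" for m
      by (intro integrable_continuous_real continuous_on_compose2[OF continuous_on_arc_majorant[of UNIV]]
          continuous_intros) auto
    show "norm (arc_majorant ?A m (cis t)) \<le> 1" for m t
      using arc_majorant_bounds[of ?A m "cis t"] by simp
    show "(\<lambda>m. arc_majorant ?A m (cis t)) \<longlonglongrightarrow> ?I t" for t
    proof (cases "cis t \<in> ?A")
      case True
      then show ?thesis by (simp only: arc_majorant_eq_1 if_True tendsto_const)
    next
      case False
      then have pos: "infdist (cis t) ?A > 0"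
        using clA by (intro infdist_pos_not_in_closed)
      have "eventually (\<lambda>m. arc_majorant ?A m (cis t) = 0) sequentially"
      proof (rule eventually_sequentiallyI)
        fix m assume "nat \<lceil>1 / infdist (cis t) ?A\<rceil> \<le> m"
        then have "1 / infdist (cis t) ?A \<le> real m" by linarith
        then show "arc_majorant ?A m (cis t) = 0"
          using pos by (simp add: arc_majorant_def field_simps)
      qed
      then show ?thesis using False by (simp only: if_False) (rule tendsto_eventually)
    qed
  qed auto
  have "((\<lambda>t. if t \<in> {\<theta>..\<phi>} then 1 else 0 :: real) has_integral (\<phi> - \<theta>)) {0..2 * pi}"
    using assms has_integral_const_real[of "1::real" \<theta> \<phi>]
    by (subst has_integral_restrict) auto
  then have "(?I has_integral (\<phi> - \<theta>)) {0..2 * pi}"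
  proof (rule has_integral_spike_finite[where S = "{0, 2 * pi}", rotated 2])
    fix t assume t: "t \<in> {0..2 * pi} - {0, 2 * pi}"
    have "t \<in> {\<theta>..\<phi>}" if inA: "cis t \<in> ?A"
    proof -
      obtain s where s: "s \<in> {\<theta>..\<phi>}" "cis t = cis s" using inA by auto
      then have "t = s" using cis_eq_imp_endpoint[of t s] t assms by auto
      with s show ?thesis by simp
    qed
    then have "cis t \<in> ?A \<longleftrightarrow> t \<in> {\<theta>..\<phi>}" by blast
    then show "?I t = (if t \<in> {\<theta>..\<phi>} then 1 else 0)" by (simp only:)
  qed simp
  then have "integral {0..2 * pi} ?I = \<phi> - \<theta>" by (rule integral_unique)
  with lim show ?thesis by simp
qed

text \<open>
The indicator of an arc is majorised by a trigonometric polynomial whose mean is barely larger than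
the normalised length of the arc.  Only the upper estimate is proved this way; the lower one follows by
counting the complement.
\<close>
lemma arc_count_le:
  assumes arc: "0 \<le> \<theta>" "\<theta> \<le> \<phi>" "\<phi> \<le> 2 * pi" and e: "e > 0"
  shows "\<exists>C. \<forall>n (t :: nat \<Rightarrow> real) B. power_sums_bounded n t B \<longrightarrow>
     real (card {i. i < n \<and> \<theta> \<le> t i \<and> t i < \<phi>}) \<le> real n * ((\<phi> - \<theta>) / (2 * pi) + e) + C * B"
proof -
  let ?A = "cis ` {\<theta>..\<phi>}"
  \<comment> \<open>one \<open>d\<close> pays for the tent function and two for the uniform approximation, once to go from the tent to \<open>h\<close> and once to stay above it\<close>
  define d where "d = e / 3"
  have d: "d > 0" using e by (simp add: d_def)
  then have "2 * pi * d > 0" by simp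
  from order_tendstoD(2)[OF integral_arc_majorant_tendsto[OF arc], of "\<phi> - \<theta> + 2 * pi * d"] this
  have "eventually (\<lambda>m. integral {0..2 * pi} (\<lambda>t. arc_majorant ?A m (cis t)) < \<phi> - \<theta> + 2 * pi * d) sequentially"
    by simp
  then obtain m where m: "integral {0..2 * pi} (\<lambda>t. arc_majorant ?A m (cis t)) < \<phi> - \<theta> + 2 * pi * d"
    by (auto simp: eventually_sequentially)
  obtain h where h: "real_polynomial_function h"
    "\<And>x. x \<in> sphere 0 1 \<Longrightarrow> \<bar>arc_majorant ?A m x - h x\<bar> < d"
    using Stone_Weierstrass_real_polynomial_function[OF compact_sphere continuous_on_arc_majorant d, of 0 1 ?A m]
    by blast
  obtain c C where c: "((\<lambda>t. of_real (h (cis t)) :: complex) has_integral of_real (2 * pi) * c) {0..2 * pi}"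
    and C: "\<And>n (t :: nat \<Rightarrow> real) B. power_sums_bounded n t B \<Longrightarrow>
        norm ((\<Sum>i<n. of_real (h (cis (t i)))) - of_nat n * c) \<le> C * B"
    using trig_poly_equidistribution[OF trig_poly_real_polynomial_on_circle[OF h(1)]] by metis
  have Re_c: "Re c \<le> (\<phi> - \<theta>) / (2 * pi) + 2 * d"
  proof -
    have "((\<lambda>t. h (cis t)) has_integral 2 * pi * Re c) {0..2 * pi}"
      using has_integral_Re[OF c] by simp
    moreover have "((\<lambda>t. arc_majorant ?A m (cis t) + d) has_integral
        integral {0..2 * pi} (\<lambda>t. arc_majorant ?A m (cis t)) + 2 * pi * d) {0..2 * pi}"
      using has_integral_const_real[of d 0 "2 * pi"]
      by (intro has_integral_add integrable_integral integrable_continuous_real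
            continuous_on_compose2[OF continuous_on_arc_majorant[of UNIV]] continuous_intros) auto
    ultimately have "2 * pi * Re c \<le> integral {0..2 * pi} (\<lambda>t. arc_majorant ?A m (cis t)) + 2 * pi * d"
    proof (rule has_integral_le)
      fix t show "h (cis t) \<le> arc_majorant ?A m (cis t) + d" using h(2)[of "cis t"] by auto
    qed
    with m have "2 * pi * Re c \<le> \<phi> - \<theta> + 2 * pi * (2 * d)" by (simp add: algebra_simps)
    then show ?thesis by (simp add: field_simps)
  qed
  have "real (card {i. i < n \<and> \<theta> \<le> t i \<and> t i < \<phi>}) \<le> real n * ((\<phi> - \<theta>) / (2 * pi) + e) + C * B"
    if H: "power_sums_bounded n t B" for n B and t :: "nat \<Rightarrow> real"
  proof -
    have "real (card {i. i < n \<and> \<theta> \<le> t i \<and> t i < \<phi>}) = (\<Sum>i<n. if \<theta> \<le> t i \<and> t i < \<phi> then 1 else 0)"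
      by (simp add: sum.If_cases Int_def)
    also have "\<dots> \<le> (\<Sum>i<n. h (cis (t i)) + d)"
    proof (rule sum_mono)
      fix i
      have "\<bar>arc_majorant ?A m (cis (t i)) - h (cis (t i))\<bar> < d" using h(2) by simp
      moreover have "arc_majorant ?A m (cis (t i)) = 1" if "\<theta> \<le> t i \<and> t i < \<phi>"
        using that by (intro arc_majorant_eq_1) auto
      ultimately show "(if \<theta> \<le> t i \<and> t i < \<phi> then 1 else 0) \<le> h (cis (t i)) + d"
        using arc_majorant_bounds(1)[of ?A m "cis (t i)"] by (cases "\<theta> \<le> t i \<and> t i < \<phi>") (auto simp: abs_if split: if_splits)
    qed
    also have "\<dots> = (\<Sum>i<n. h (cis (t i))) + real n * d" by (simp add: sum.distrib)
    also have "(\<Sum>i<n. h (cis (t i))) \<le> real n * Re c + C * B"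
      using abs_Re_le_cmod[of "(\<Sum>i<n. of_real (h (cis (t i)))) - of_nat n * c"] C[OF H] by simp
    also have "real n * Re c \<le> real n * ((\<phi> - \<theta>) / (2 * pi) + 2 * d)"
      using Re_c by (intro mult_left_mono) auto
    also have "real n * ((\<phi> - \<theta>) / (2 * pi) + 2 * d) + C * B + real n * d
        = real n * ((\<phi> - \<theta>) / (2 * pi) + e) + C * B"
      by (simp add: d_def algebra_simps)
    finally show ?thesis by simp
  qed
  then show ?thesis by blast
qed

text \<open>
The complement of \<open>[\<theta>, \<phi>)\<close> in \<open>[0, 2 * pi)\<close> consists of two arcs; the upper estimates for
these give the lower estimate for the arc itself.
\<close>
lemma arc_count_equidistribution:
  assumes arc: "0 \<le> \<theta>" "\<theta> \<le> \<phi>" "\<phi> \<le> 2 * pi" and e: "e > 0"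
  shows "\<exists>C\<ge>0. \<forall>n (t :: nat \<Rightarrow> real) B. (\<forall>i<n. 0 \<le> t i \<and> t i < 2 * pi) \<longrightarrow> power_sums_bounded n t B \<longrightarrow>
     \<bar>real (card {i. i < n \<and> \<theta> \<le> t i \<and> t i < \<phi>}) - real n * ((\<phi> - \<theta>) / (2 * pi))\<bar> \<le> real n * e + C * B"
proof -
  have e2: "e / 2 > 0" using e by simp
  note le = arc_count_le[OF _ _ _ e2]
  obtain C1 where C1: "\<And>n (t :: nat \<Rightarrow> real) B. power_sums_bounded n t B \<Longrightarrow>
     real (card {i. i < n \<and> \<theta> \<le> t i \<and> t i < \<phi>}) \<le> real n * ((\<phi> - \<theta>) / (2 * pi) + e / 2) + C1 * B"
    using le[of \<theta> \<phi>] arc by blast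
  obtain C2 where C2: "\<And>n (t :: nat \<Rightarrow> real) B. power_sums_bounded n t B \<Longrightarrow>
     real (card {i. i < n \<and> 0 \<le> t i \<and> t i < \<theta>}) \<le> real n * ((\<theta> - 0) / (2 * pi) + e / 2) + C2 * B"
    using le[of 0 \<theta>] arc by auto
  obtain C3 where C3: "\<And>n (t :: nat \<Rightarrow> real) B. power_sums_bounded n t B \<Longrightarrow>
     real (card {i. i < n \<and> \<phi> \<le> t i \<and> t i < 2 * pi}) \<le> real n * ((2 * pi - \<phi>) / (2 * pi) + e / 2) + C3 * B"
    using le[of \<phi> "2 * pi"] arc by auto
  define C where "C = \<bar>C1\<bar> + \<bar>C2\<bar> + \<bar>C3\<bar>"
  show ?thesis
  proof (intro exI[of _ C] conjI allI impI)
    show "C \<ge> 0" by (simp add: C_def)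
    fix n B and t :: "nat \<Rightarrow> real"
    assume t: "\<forall>i<n. 0 \<le> t i \<and> t i < 2 * pi" and H: "power_sums_bounded n t B"
    have B: "B \<ge> 0"
      using order_trans[OF norm_ge_zero, of _ "real 1 * B"] H unfolding power_sums_bounded_def by fastforce
    let ?c = "\<lambda>a b. {i. i < n \<and> a \<le> t i \<and> t i < b}"
    have "{..<n} = ?c \<theta> \<phi> \<union> (?c 0 \<theta> \<union> ?c \<phi> (2 * pi))" using t by force
    then have "n = card (?c \<theta> \<phi> \<union> (?c 0 \<theta> \<union> ?c \<phi> (2 * pi)))" by (metis card_lessThan)
    also have "\<dots> = card (?c \<theta> \<phi>) + (card (?c 0 \<theta>) + card (?c \<phi> (2 * pi)))"
      using arc by (subst card_Un_disjoint; (subst card_Un_disjoint)?) auto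
    finally have total: "real n = real (card (?c \<theta> \<phi>)) + real (card (?c 0 \<theta>)) + real (card (?c \<phi> (2 * pi)))"
      by linarith
    have "C1 * B \<le> C * B" "C2 * B + C3 * B \<le> C * B"
      unfolding distrib_right[symmetric] by (intro mult_right_mono B; simp add: C_def abs_if)+
    moreover have "real n * ((\<theta> - 0) / (2 * pi) + e / 2) + real n * ((2 * pi - \<phi>) / (2 * pi) + e / 2)
        = real n + real n * e - real n * ((\<phi> - \<theta>) / (2 * pi))"
      by (simp add: field_simps)
    moreover have "real n * ((\<phi> - \<theta>) / (2 * pi) + e / 2) \<le> real n * ((\<phi> - \<theta>) / (2 * pi)) + real n * e"
      using e by (simp add: field_simps)
    ultimately show "\<bar>real (card (?c \<theta> \<phi>)) - real n * ((\<phi> - \<theta>) / (2 * pi))\<bar> \<le> real n * e + C * B"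
      using C1[OF H] C2[OF H] C3[OF H] total by linarith
  qed
qed

text \<open>
An asymptotic form of the Erdos--Turan theorem.  The constant depends on the arc and on \<open>e\<close>, but
not on the polynomial or its degree, which is what makes the estimate usable both pointwise and after
taking expectations.
\<close>
lemma sector_count_equidistribution:
  assumes "0 \<le> \<theta>" "\<theta> \<le> \<phi>" "\<phi> \<le> 2 * pi" "e > 0"
  shows "\<exists>C\<ge>0. \<forall>p n z. factored_poly p n z \<longrightarrow>
     \<bar>real (sector_count p \<theta> \<phi>) - real n * ((\<phi> - \<theta>) / (2 * pi))\<bar> \<le> real n * e + C * poly_log_ratio p"
proof -
  obtain C where C: "C \<ge> 0" "\<forall>n (t :: nat \<Rightarrow> real) B. (\<forall>i<n. 0 \<le> t i \<and> t i < 2 * pi) \<longrightarrow> power_sums_bounded n t B \<longrightarrow>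
     \<bar>real (card {i. i < n \<and> \<theta> \<le> t i \<and> t i < \<phi>}) - real n * ((\<phi> - \<theta>) / (2 * pi))\<bar> \<le> real n * e + C * B"
    using arc_count_equidistribution[OF assms] by blast
  show ?thesis
  proof (intro exI[of _ "2 * C"] conjI allI impI)
    fix p n z assume "factored_poly p n z"
    then interpret factored_poly p n z .
    have "sgn x = cis (Arg2pi x)" if "x \<noteq> 0" for x
      using Arg2pi_eq[of x] that by (simp add: sgn_eq cis_conv_exp field_simps)
    then have cis: "cis (real k * Arg2pi (z i)) = sgn (z i) ^ k" if "i < n" for k i
      using root_nonzero[OF that] by (simp add: Complex.DeMoivre)
    have "\<bar>real (card {i. i < n \<and> \<theta> \<le> Arg2pi (z i) \<and> Arg2pi (z i) < \<phi>}) - real n * ((\<phi> - \<theta>) / (2 * pi))\<bar>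
        \<le> real n * e + C * (2 * poly_log_ratio p)"
    proof (rule C(2)[rule_format])
      show "0 \<le> Arg2pi (z i) \<and> Arg2pi (z i) < 2 * pi" for i
        by (simp add: Arg2pi_ge_0 Arg2pi_lt_2pi)
      show "power_sums_bounded n (\<lambda>i. Arg2pi (z i)) (2 * poly_log_ratio p)"
        unfolding power_sums_bounded_def using norm_power_sum_sgn_roots_le by (simp add: cis mult_ac)
    qed
    then show "\<bar>real (sector_count p \<theta> \<phi>) - real n * ((\<phi> - \<theta>) / (2 * pi))\<bar>
        \<le> real n * e + 2 * C * poly_log_ratio p"
      unfolding sector_count_def card_roots_eq_size_filter_proots[symmetric] by (simp add: mult_ac)
  qed (use C in simp)
qed

section \<open>Measurability of the number of zeros in a set\<close>

text \<open>
By compactness and continuity, a zero exists in \<open>K\<close> exactly if the infimum over a countable dense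
subset of \<open>K\<close> is zero, which is a countable condition on \<open>\<omega>\<close>.
\<close>
lemma sets_ex_zero_in_compact:
  fixes F :: "'w \<Rightarrow> 'b::second_countable_topology \<Rightarrow> real"
  assumes K: "compact K"
    and meas: "\<And>x. (\<lambda>\<omega>. F \<omega> x) \<in> borel_measurable M"
    and cont: "\<And>\<omega>. continuous_on UNIV (F \<omega>)"
    and nonneg: "\<And>\<omega> x. F \<omega> x \<ge> 0"
  shows "{\<omega> \<in> space M. \<exists>x\<in>K. F \<omega> x = 0} \<in> sets M"
proof -
  obtain \<B> :: "'b set set" where \<B>: "countable \<B>" "topological_basis \<B>"
    using ex_countable_basis by blast
  define D where "D = (\<lambda>b. SOME x. x \<in> b \<inter> K) ` {b \<in> \<B>. b \<inter> K \<noteq> {}}"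
  have D_count: "countable D" unfolding D_def using \<B>(1) by auto
  have pick: "(SOME x. x \<in> b \<inter> K) \<in> b \<inter> K" if "b \<inter> K \<noteq> {}" for b
    using that by (meson ex_in_conv someI_ex)
  have D_sub: "D \<subseteq> K" unfolding D_def using pick by auto
  have dense: "\<exists>y\<in>D. F \<omega> y < e" if x: "x \<in> K" "F \<omega> x < e" for \<omega> x e
  proof -
    have "open {y. F \<omega> y < e}" using cont by (intro open_Collect_less continuous_on_const)
    moreover have "x \<in> {y. F \<omega> y < e}" using x by simp
    ultimately obtain b where b: "b \<in> \<B>" "x \<in> b" "b \<subseteq> {y. F \<omega> y < e}"
      using \<B>(2) by (meson topological_basisE)
    then have "b \<inter> K \<noteq> {}" using x by auto
    from pick[OF this] b this show ?thesis unfolding D_def by blast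
  qed
  have "(\<exists>x\<in>K. F \<omega> x = 0) \<longleftrightarrow> (\<forall>m. \<exists>y\<in>D. F \<omega> y < 1 / real (Suc m))" for \<omega>
  proof
    assume "\<exists>x\<in>K. F \<omega> x = 0"
    then show "\<forall>m. \<exists>y\<in>D. F \<omega> y < 1 / real (Suc m)" using dense by fastforce
  next
    assume *: "\<forall>m. \<exists>y\<in>D. F \<omega> y < 1 / real (Suc m)"
    then have "K \<noteq> {}" using D_sub by blast
    then obtain x where x: "x \<in> K" "\<And>y. y \<in> K \<Longrightarrow> F \<omega> x \<le> F \<omega> y"
      using continuous_attains_inf[OF K _ continuous_on_subset[OF cont[of \<omega>]]] by auto
    have "F \<omega> x < 1 / real (Suc m)" for m using * x(2) D_sub by (meson le_less_trans subsetD)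
    then have "F \<omega> x \<le> 0" by (metis inverse_eq_divide not_le reals_Archimedean less_asym)
    with nonneg[of \<omega> x] x(1) show "\<exists>x\<in>K. F \<omega> x = 0" by (intro bexI[of _ x]) auto
  qed
  then have "{\<omega> \<in> space M. \<exists>x\<in>K. F \<omega> x = 0}
      = (\<Inter>m. \<Union>y\<in>D. {\<omega> \<in> space M. F \<omega> y < 1 / real (Suc m)})"
    by auto
  also have "\<dots> \<in> sets M"
    using D_count meas by (intro sets.countable_INT image_subsetI sets.countable_UN') auto
  finally show ?thesis .
qed

lemma compact_fun_box:
  fixes B :: "nat \<Rightarrow> complex set"
  assumes "\<And>i. compact (B i)"
  shows "compact {z. \<forall>i. z i \<in> B i}"
proof -
  have "compactin (product_topology (\<lambda>i. euclidean) UNIV) (PiE UNIV B)"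
    unfolding compactin_PiE using assms by auto
  moreover have "PiE UNIV B = {z. \<forall>i. z i \<in> B i}" by (auto simp: PiE_def)
  ultimately show ?thesis by (simp add: euclidean_product_topology)
qed

text \<open>
Testing the factorisation at \<open>N + 1\<close> points makes it a condition that is visibly continuous in the
candidate zeros \<open>z\<close>.
\<close>
lemma poly_eq_smult_prod_iff:
  fixes p :: "complex poly"
  assumes "degree p \<le> N" "d \<le> N"
  shows "(\<forall>x\<le>N. poly p (of_nat x) = c * (\<Prod>i<d. of_nat x - z i)) \<longleftrightarrow> p = smult c (\<Prod>i<d. [:- z i, 1:])"
proof
  let ?q = "smult c (\<Prod>i<d. [:- z i, 1:])"
  assume *: "\<forall>x\<le>N. poly p (of_nat x) = c * (\<Prod>i<d. of_nat x - z i)"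
  have card: "card ((of_nat :: nat \<Rightarrow> complex) ` {..N}) = Suc N"
    by (subst card_image) (auto simp: inj_on_def)
  have "degree ?q \<le> d"
    by (rule order_trans[OF degree_smult_le]) (simp add: degree_prod_sum_eq)
  with card assms * show "p = ?q"
    by (intro poly_eqI_degree[of "of_nat ` {..N}"]) (auto simp: poly_prod)
qed (auto simp: poly_prod)

text \<open>
Having at least \<open>m\<close> zeros in a \<open>\<sigma>\<close>-compact set is the existence of a factorisation whose
vector of zeros lies in one of countably many compact boxes.  The box restricts the coordinates in
\<open>I\<close> to the set and all others, also those beyond the degree, to a large ball: without a bound on
every coordinate it would not be compact.
\<close>
lemma root_count_ge_iff:
  fixes p :: "complex poly" and K :: "nat \<Rightarrow> complex set"
  assumes p: "p \<noteq> 0" "degree p \<le> N" and mono: "mono K" and Q: "{z. Q z} = (\<Union>j. K j)"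
  shows "m \<le> size (filter_mset Q (proots p)) \<longleftrightarrow>
    (\<exists>I\<in>{I. I \<subseteq> {..<degree p} \<and> card I = m}. \<exists>j :: nat. \<exists>z\<in>{z. \<forall>i. z i \<in> (if i \<in> I then K j else cball 0 (real j))}.
        \<forall>x\<le>N. poly p (of_nat x) = lead_coeff p * (\<Prod>i<degree p. of_nat x - z i))"
  (is "_ \<longleftrightarrow> ?R")
proof
  assume m: "m \<le> size (filter_mset Q (proots p))"
  obtain z where z: "smult (lead_coeff p) (\<Prod>i<degree p. [:-z i, 1:]) = p"
    using complex_poly_decompose' by metis
  with m p have "m \<le> card {i. i < degree p \<and> Q (z i)}"
    by (subst (asm) size_filter_proots_eq_card[OF z[symmetric]]) auto
  then obtain I where I: "I \<subseteq> {i. i < degree p \<and> Q (z i)}" "card I = m"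
    by (meson obtain_subset_with_card_n)
  \<comment> \<open>the coordinates beyond the degree are arbitrary and must be reset to land in the ball\<close>
  define y where "y = (\<lambda>i. if i < degree p then z i else 0)"
  have "\<exists>J. \<forall>j\<ge>J. y i \<in> (if i \<in> I then K j else cball 0 (real j))" for i
  proof (cases "i \<in> I")
    case True
    then have "z i \<in> (\<Union>j. K j)" using I Q by auto
    then obtain J where J: "z i \<in> K J" by blast
    moreover have "y i = z i" using True I by (auto simp: y_def)
    ultimately show ?thesis using monoD[OF mono] True by (metis subsetD)
  next
    case False
    have "norm (y i) \<le> real j" if "nat \<lceil>norm (y i)\<rceil> \<le> j" for j using that by linarith
    then show ?thesis using False by (intro exI[of _ "nat \<lceil>norm (y i)\<rceil>"]) auto
  qed
  then obtain J where J: "\<And>i j. j \<ge> J i \<Longrightarrow> y i \<in> (if i \<in> I then K j else cball 0 (real j))" by metis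
  define j where "j = Max (J ` {..<degree p} \<union> {0})"
  have "y i \<in> (if i \<in> I then K j else cball 0 (real j))" for i
  proof (cases "i < degree p")
    case True
    then show ?thesis by (intro J) (auto simp: j_def)
  next
    case False
    moreover have "i \<notin> I" using False I by auto
    ultimately show ?thesis by (simp add: y_def)
  qed
  moreover have "\<forall>x\<le>N. poly p (of_nat x) = lead_coeff p * (\<Prod>i<degree p. of_nat x - y i)"
  proof -
    have "(\<Prod>i<degree p. [:- y i, 1:]) = (\<Prod>i<degree p. [:- z i, 1:])"
      by (intro prod.cong) (auto simp: y_def)
    then show ?thesis using p z by (subst poly_eq_smult_prod_iff) simp_all
  qed
  ultimately show ?R using I by (intro bexI[of _ I] exI[of _ j] bexI[of _ y]) auto
next
  assume ?R
  then obtain I j z where I: "I \<subseteq> {..<degree p}" "card I = m"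
    and z: "\<And>i. z i \<in> (if i \<in> I then K j else cball 0 (real j))"
    and eq: "\<forall>x\<le>N. poly p (of_nat x) = lead_coeff p * (\<Prod>i<degree p. of_nat x - z i)" by blast
  have p_eq: "p = smult (lead_coeff p) (\<Prod>i<degree p. [:- z i, 1:])"
    using eq by (subst (asm) poly_eq_smult_prod_iff) (use p in auto)
  have "Q (z i)" if "i \<in> I" for i using z[of i] that Q by auto
  then have "I \<subseteq> {i. i < degree p \<and> Q (z i)}" using I by auto
  then have "card I \<le> card {i. i < degree p \<and> Q (z i)}" by (intro card_mono) auto
  then show "m \<le> size (filter_mset Q (proots p))"
    using I p by (subst size_filter_proots_eq_card[OF p_eq]) auto
qed

text \<open>
The probability space is split according to the degree of the random polynomial; on each part the
leading coefficient is a fixed random variable and \<open>root_count_ge_iff\<close> exhibits the upper level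
sets of the count as countable unions of measurable sets.  The split by degree is what gives
measurability on the null sets where the top coefficients vanish.
\<close>
lemma measurable_root_count:
  fixes a :: "nat \<Rightarrow> 'w \<Rightarrow> complex" and K :: "nat \<Rightarrow> complex set"
  assumes a: "\<And>k. k \<le> N \<Longrightarrow> a k \<in> borel_measurable M"
    and K: "\<And>j. compact (K j)" and mono: "mono K" and Q: "{z. Q z} = (\<Union>j. K j)"
  shows "(\<lambda>\<omega>. real (size (filter_mset Q (proots (\<Sum>k\<le>N. monom (a k \<omega>) k))))) \<in> borel_measurable M"
proof -
  define P where "P = (\<lambda>\<omega>. \<Sum>k\<le>N. monom (a k \<omega>) k)"
  have poly_P: "poly (P \<omega>) x = (\<Sum>k\<le>N. a k \<omega> * x ^ k)" for \<omega> x
    by (simp add: P_def poly_sum poly_monom)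
  have coeff_P: "coeff (P \<omega>) k = (if k \<le> N then a k \<omega> else 0)" for \<omega> k
    by (simp add: P_def coeff_sum)
  have deg_P: "degree (P \<omega>) \<le> N" for \<omega>
    by (rule degree_le) (simp add: coeff_P)
  define F where "F = (\<lambda>d \<omega> z. \<Sum>x\<le>N. norm (poly (P \<omega>) (of_nat x) - a d \<omega> * (\<Prod>i<d. of_nat x - z i)))"
  define Box where "Box = (\<lambda>I j. {z :: nat \<Rightarrow> complex. \<forall>i. z i \<in> (if i \<in> I then K j else cball 0 (real j))})"
  define E where "E = (\<lambda>d. {\<omega> \<in> space M. a d \<omega> \<noteq> 0 \<and> (\<forall>k\<in>{d<..N}. a k \<omega> = 0)})"
  define H where "H = (\<lambda>m d. \<Union>I\<in>{I. I \<subseteq> {..<d} \<and> card I = m}. \<Union>j. {\<omega> \<in> space M. \<exists>z\<in>Box I j. F d \<omega> z = 0})"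
  have E_sets: "E d \<in> sets M" if "d \<le> N" for d
  proof -
    have zero: "a k -` {0} \<inter> space M \<in> sets M" if "k \<le> N" for k
      using a[OF that] by (rule measurable_sets) simp
    have "E d = space M - ((a d -` {0} \<inter> space M) \<union> (\<Union>k\<in>{d<..N}. space M - (a k -` {0} \<inter> space M)))"
      by (auto simp: E_def)
    also have "\<dots> \<in> sets M"
      using zero that by (intro sets.Diff sets.Un sets.finite_UN sets.top) auto
    finally show ?thesis .
  qed
  have H_sets: "H m d \<in> sets M" if d: "d \<le> N" for m d
    unfolding H_def
  proof (rule sets.finite_UN)
    show "finite {I. I \<subseteq> {..<d} \<and> card I = m}" by simp
    fix I :: "nat set"
    show "(\<Union>j. {\<omega> \<in> space M. \<exists>z\<in>Box I j. F d \<omega> z = 0}) \<in> sets M"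
    proof (rule sets.countable_UN, rule image_subsetI, rule sets_ex_zero_in_compact)
      fix j
      show "compact (Box I j)" unfolding Box_def by (rule compact_fun_box) (use K in auto)
      show "(\<lambda>\<omega>. F d \<omega> z) \<in> borel_measurable M" for z
        unfolding F_def poly_P using a d by (intro borel_measurable_sum borel_measurable_norm borel_measurable_diff
          borel_measurable_times borel_measurable_const) auto
      show "continuous_on UNIV (F d \<omega>)" for \<omega>
        unfolding F_def by (intro continuous_intros continuous_on_product_coordinates)
      show "F d \<omega> z \<ge> 0" for \<omega> z unfolding F_def by (rule sum_nonneg) simp
    qed
  qed
  have F_0: "F d \<omega> z = 0 \<longleftrightarrow> (\<forall>x\<le>N. poly (P \<omega>) (of_nat x) = a d \<omega> * (\<Prod>i<d. of_nat x - z i))" for d \<omega> z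
    unfolding F_def by (subst sum_nonneg_eq_0_iff) auto
  have on_E: "P \<omega> \<noteq> 0 \<and> degree (P \<omega>) = d" if "\<omega> \<in> E d" "d \<le> N" for d \<omega>
  proof
    show nz: "P \<omega> \<noteq> 0" using that coeff_P[of \<omega> d] by (auto simp: E_def)
    show "degree (P \<omega>) = d"
    proof (rule antisym)
      show "degree (P \<omega>) \<le> d" using that by (intro degree_le) (auto simp: coeff_P E_def)
      show "d \<le> degree (P \<omega>)" using that by (intro le_degree) (auto simp: coeff_P E_def)
    qed
  qed
  have in_E: "\<omega> \<in> E (degree (P \<omega>))" if "P \<omega> \<noteq> 0" "\<omega> \<in> space M" for \<omega>
  proof -
    have "a (degree (P \<omega>)) \<omega> \<noteq> 0" using coeff_P[of \<omega> "degree (P \<omega>)"] that deg_P[of \<omega>] by auto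
    moreover have "a k \<omega> = 0" if "degree (P \<omega>) < k" "k \<le> N" for k
      using coeff_eq_0[OF that(1)] coeff_P[of \<omega> k] that by simp
    ultimately show ?thesis using that by (simp add: E_def)
  qed
  have level: "{\<omega> \<in> space M. m \<le> size (filter_mset Q (proots (P \<omega>)))} \<in> sets M" for m
  proof (cases "m = 0")
    case False
    have iff: "m \<le> size (filter_mset Q (proots (P \<omega>))) \<longleftrightarrow> \<omega> \<in> H m d" if "\<omega> \<in> E d" "d \<le> N" for \<omega> d
    proof -
      have nz: "P \<omega> \<noteq> 0" and deg: "degree (P \<omega>) = d" using on_E[OF that] by auto
      have lead: "coeff (P \<omega>) d = a d \<omega>" using that by (simp add: coeff_P)
      have "\<omega> \<in> space M" using that by (simp add: E_def)
      then show ?thesis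
        unfolding root_count_ge_iff[OF nz deg_P mono Q] deg lead H_def Box_def F_0 by simp
    qed
    have "{\<omega> \<in> space M. m \<le> size (filter_mset Q (proots (P \<omega>)))} = (\<Union>d\<in>{..N}. E d \<inter> H m d)"
    proof (intro equalityI subsetI)
      fix \<omega> assume \<omega>: "\<omega> \<in> {\<omega> \<in> space M. m \<le> size (filter_mset Q (proots (P \<omega>)))}"
      then have "P \<omega> \<noteq> 0" using False by auto
      with \<omega> iff in_E deg_P show "\<omega> \<in> (\<Union>d\<in>{..N}. E d \<inter> H m d)" by blast
    next
      fix \<omega> assume "\<omega> \<in> (\<Union>d\<in>{..N}. E d \<inter> H m d)"
      then show "\<omega> \<in> {\<omega> \<in> space M. m \<le> size (filter_mset Q (proots (P \<omega>)))}"
        using iff by (auto simp: E_def)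
    qed
    also have "\<dots> \<in> sets M" using E_sets H_sets by auto
    finally show ?thesis .
  qed simp
  show ?thesis unfolding P_def[symmetric, THEN fun_cong]
  proof (subst borel_measurable_iff_ge, intro allI)
    fix r :: real
    have "{\<omega> \<in> space M. r \<le> real (size (filter_mset Q (proots (P \<omega>))))}
        = {\<omega> \<in> space M. nat \<lceil>r\<rceil> \<le> size (filter_mset Q (proots (P \<omega>)))}" by (auto; linarith)
    then show "{\<omega> \<in> space M. r \<le> real (size (filter_mset Q (proots (P \<omega>))))} \<in> sets M"
      using level[of "nat \<lceil>r\<rceil>"] by (simp only:)
  qed
qed

lemma measurable_annulus_count:
  assumes a: "\<And>k. k \<le> N \<Longrightarrow> a N k \<in> borel_measurable M"
  shows "(\<lambda>\<omega>. real (annulus_count (row_poly a N \<omega>) \<rho>)) \<in> borel_measurable M"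
  unfolding annulus_count_def row_poly_def
proof (rule measurable_root_count[OF a])
  let ?A = "{z. 1 - \<rho> \<le> norm z \<and> (\<rho> = 1 \<or> norm z \<le> 1 / (1 - \<rho>))} :: complex set"
  let ?K = "\<lambda>j. ?A \<inter> cball 0 (real j)"
  have "closed ?A"
    by (intro closed_Collect_conj closed_Collect_disj closed_Collect_const closed_Collect_le continuous_intros)
  then show "compact (?K j)" for j by (intro closed_Int_compact compact_cball)
  show "mono ?K" by (intro monoI) auto
  show "?A = (\<Union>j. ?K j)" using real_arch_simple by auto
qed

text \<open>
A half-open sector is \<open>\<sigma>\<close>-compact because it is exhausted by closed annular sectors; the origin
has argument \<open>0\<close> and has to be added by hand when \<open>\<theta> = 0\<close>.
\<close>
lemma measurable_sector_count:
  assumes a: "\<And>k. k \<le> N \<Longrightarrow> a N k \<in> borel_measurable M"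
    and arc: "0 \<le> \<theta>" "\<theta> < \<phi>" "\<phi> \<le> 2 * pi"
  shows "(\<lambda>\<omega>. real (sector_count (row_poly a N \<omega>) \<theta> \<phi>)) \<in> borel_measurable M"
  unfolding sector_count_def row_poly_def
proof (rule measurable_root_count[OF a])
  let ?A = "{z. \<theta> \<le> Arg2pi z \<and> Arg2pi z < \<phi>}"
  let ?S = "\<lambda>j. (\<lambda>x. of_real (fst x) * cis (snd x)) ` ({1 / real (Suc j)..real j} \<times> {\<theta>..\<phi> - 1 / real (Suc j)})"
  let ?K = "\<lambda>j. ?S j \<union> (if \<theta> = 0 then {0} else {})"
  have "compact (?S j)" for j
    by (intro compact_continuous_image compact_Times continuous_intros) auto
  then show "compact (?K j)" for j by (intro compact_Un) auto
  show "mono ?K"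
  proof (intro monoI Un_mono order_refl image_mono Sigma_mono)
    fix i j :: nat assume "i \<le> j"
    then have "1 / real (Suc j) \<le> 1 / real (Suc i)" "real i \<le> real j" by (auto simp: frac_le)
    then show "{1 / real (Suc i)..real i} \<subseteq> {1 / real (Suc j)..real j}"
      "\<And>x. {\<theta>..\<phi> - 1 / real (Suc i)} \<subseteq> {\<theta>..\<phi> - 1 / real (Suc j)}" by auto
  qed
  show "?A = (\<Union>j. ?K j)"
  proof (intro equalityI subsetI)
    fix z assume z: "z \<in> ?A"
    show "z \<in> (\<Union>j. ?K j)"
    proof (cases "z = 0")
      case True
      then show ?thesis using z arc by (auto simp: Arg2pi_0)
    next
      case False
      have ev: "eventually (\<lambda>j. 1 / real (Suc j) < e) sequentially" if "e > 0" for e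
        using order_tendstoD(2)[OF LIMSEQ_inverse_real_of_nat that] by (simp add: inverse_eq_divide)
      have "eventually (\<lambda>j. norm z \<le> real j) sequentially"
        using filterlim_real_sequentially by (auto simp: filterlim_at_top)
      with ev[of "norm z"] ev[of "\<phi> - Arg2pi z"] False z
      have "eventually (\<lambda>j. 1 / real (Suc j) < norm z \<and> 1 / real (Suc j) < \<phi> - Arg2pi z \<and> norm z \<le> real j) sequentially"
        by (auto simp: eventually_conj_iff)
      then obtain j where j: "1 / real (Suc j) < norm z" "1 / real (Suc j) < \<phi> - Arg2pi z" "norm z \<le> real j"
        by (auto simp: eventually_sequentially)
      have "z = of_real (norm z) * cis (Arg2pi z)" using Arg2pi_eq[of z] by (simp add: cis_conv_exp)
      then have "z \<in> ?S j"
        using j z by (intro image_eqI[of _ _ "(norm z, Arg2pi z)"]) auto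
      then show ?thesis by blast
    qed
  next
    fix z assume "z \<in> (\<Union>j. ?K j)"
    then obtain j where "z \<in> ?S j \<or> z = 0 \<and> \<theta> = 0" by (auto split: if_splits)
    then show "z \<in> ?A"
    proof
      assume "z \<in> ?S j"
      then obtain r t where rt: "1 / real (Suc j) \<le> r" "\<theta> \<le> t" "t \<le> \<phi> - 1 / real (Suc j)" "z = of_real r * cis t"
        by auto
      have pos: "1 / real (Suc j) > 0" by simp
      have t: "0 < r" "0 \<le> t" "t < \<phi>" "t < 2 * pi"
        using rt(1-3) pos arc by (linarith)+
      then have "Arg2pi z = t"
        by (intro Arg2pi_unique[of r t]) (simp_all add: rt(4) cis_conv_exp)
      with rt t show "z \<in> ?A" by simp
    next
      assume "z = 0 \<and> \<theta> = 0"
      then show "z \<in> ?A" using arc by (simp add: Arg2pi_0)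
    qed
  qed
qed

section \<open>Modes of convergence\<close>

context prob_space begin

text \<open>
Markov's inequality for \<open>Z n\<close>.  The constant \<open>C\<close> may blow up as \<open>e\<close> decreases, since
\<open>e\<close> is fixed at half the deviation before \<open>n\<close> tends to infinity.
\<close>
lemma converges_in_probability_of_affine_bound:
  assumes meas: "\<forall>\<^sub>F n in sequentially. X n \<in> borel_measurable M"
    and Z_int: "\<forall>\<^sub>F n in sequentially. integrable M (Z n)"
    and Z_nonneg: "\<forall>\<^sub>F n in sequentially. AE \<omega> in M. 0 \<le> Z n \<omega>"
    and Z_lim: "(\<lambda>n. expectation (Z n)) \<longlonglongrightarrow> 0"
    and bound: "\<And>e. e > 0 \<Longrightarrow> \<exists>C\<ge>0. \<forall>\<^sub>F n in sequentially. AE \<omega> in M. \<bar>X n \<omega> - c\<bar> \<le> e + C * Z n \<omega>"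
  shows "converges_in_probability M X (\<lambda>_. c)"
  unfolding converges_in_probability_def
proof (intro conjI allI impI)
  fix e :: real assume e: "e > 0"
  then obtain C where C: "C \<ge> 0" "\<forall>\<^sub>F n in sequentially. AE \<omega> in M. \<bar>X n \<omega> - c\<bar> \<le> e / 2 + C * Z n \<omega>"
    using bound[of "e / 2"] by auto
  show "(\<lambda>n. prob {\<omega> \<in> space M. e < \<bar>X n \<omega> - c\<bar>}) \<longlonglongrightarrow> 0"
  proof (rule tendsto_sandwich[OF _ _ tendsto_const])
    show "(\<lambda>n. C * expectation (Z n) / (e / 2)) \<longlonglongrightarrow> 0"
      using tendsto_mult_left[OF Z_lim, of "C / (e / 2)"] by (simp add: field_simps)
    show "\<forall>\<^sub>F n in sequentially. 0 \<le> prob {\<omega> \<in> space M. e < \<bar>X n \<omega> - c\<bar>}" by simp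
    show "\<forall>\<^sub>F n in sequentially. prob {\<omega> \<in> space M. e < \<bar>X n \<omega> - c\<bar>} \<le> C * expectation (Z n) / (e / 2)"
      using meas Z_int Z_nonneg C(2)
    proof eventually_elim
      case (elim n)
      have "prob {\<omega> \<in> space M. e < \<bar>X n \<omega> - c\<bar>} \<le> prob {\<omega> \<in> space M. e / 2 \<le> C * Z n \<omega>}"
      proof (rule finite_measure_mono_AE)
        show "AE \<omega> in M. \<omega> \<in> {\<omega> \<in> space M. e < \<bar>X n \<omega> - c\<bar>} \<longrightarrow> \<omega> \<in> {\<omega> \<in> space M. e / 2 \<le> C * Z n \<omega>}"
          using elim(4) by eventually_elim auto
        show "{\<omega> \<in> space M. e / 2 \<le> C * Z n \<omega>} \<in> sets M"
          using elim(2) by measurable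
      qed
      also have "\<dots> \<le> (\<integral>\<omega>. C * Z n \<omega> \<partial>M) / (e / 2)"
      proof (rule integral_Markov_inequality_measure[where A = "space M"])
        show "integrable M (\<lambda>\<omega>. C * Z n \<omega>)" using elim(2) by simp
        show "AE \<omega> in M. 0 \<le> C * Z n \<omega>" using elim(3) C(1) by (auto elim!: eventually_mono)
      qed (use e in auto)
      finally show ?case by simp
    qed
  qed
qed (use meas in auto)

lemma integrable_abs_diff_powr:
  fixes X :: "'a \<Rightarrow> real"
  assumes "X \<in> borel_measurable M" "AE \<omega> in M. \<bar>X \<omega> - c\<bar> \<le> 1" "p > 0"
  shows "integrable M (\<lambda>\<omega>. \<bar>X \<omega> - c\<bar> powr p)"
proof (rule integrable_const_bound[where B = 1])
  show "AE \<omega> in M. norm (\<bar>X \<omega> - c\<bar> powr p) \<le> 1"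
    using assms(2,3) by (auto elim!: eventually_mono intro: powr_le1)
qed (use assms(1) in measurable)

lemma converges_in_mean_of_probability:
  assumes conv: "converges_in_probability M X (\<lambda>_. c)"
    and bound: "\<forall>\<^sub>F n in sequentially. AE \<omega> in M. \<bar>X n \<omega> - c\<bar> \<le> 1" and p: "p > 0"
  shows "converges_in_mean M p X (\<lambda>_. c)"
proof -
  have meas: "\<forall>\<^sub>F n in sequentially. X n \<in> borel_measurable M"
    and prob: "\<And>e. e > 0 \<Longrightarrow> (\<lambda>n. prob {\<omega> \<in> space M. \<bar>X n \<omega> - c\<bar> > e}) \<longlonglongrightarrow> 0"
    using conv by (auto simp: converges_in_probability_def)
  have int: "\<forall>\<^sub>F n in sequentially. X n \<in> borel_measurable M \<and> integrable M (\<lambda>\<omega>. \<bar>X n \<omega> - c\<bar> powr p)"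
    using meas bound by eventually_elim (auto intro: integrable_abs_diff_powr p)
  have "(\<lambda>n. \<integral>\<omega>. \<bar>X n \<omega> - c\<bar> powr p \<partial>M) \<longlonglongrightarrow> 0"
  proof (rule tendstoI)
    fix d :: real assume d: "d > 0"
    \<comment> \<open>the threshold at which the \<open>p\<close>-th power of the deviation equals half the target\<close>
    define e where "e = (d / 2) powr (1 / p)"
    have e: "e > 0" "e powr p = d / 2" using d p by (auto simp: e_def powr_powr)
    have "\<forall>\<^sub>F n in sequentially. prob {\<omega> \<in> space M. \<bar>X n \<omega> - c\<bar> > e} < d / 2"
      using order_tendstoD(2)[OF prob[OF e(1)], of "d / 2"] d by simp
    then show "\<forall>\<^sub>F n in sequentially. dist (\<integral>\<omega>. \<bar>X n \<omega> - c\<bar> powr p \<partial>M) 0 < d"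
      using int bound
    proof eventually_elim
      case (elim n)
      let ?A = "{\<omega> \<in> space M. \<bar>X n \<omega> - c\<bar> > e}"
      have [measurable]: "X n \<in> borel_measurable M" using elim(2) by simp
      have A: "?A \<in> sets M" by measurable
      have ind: "integrable M (indicat_real ?A)" and ind_eq: "expectation (indicat_real ?A) = prob ?A"
        using A by (auto intro!: integrable_real_indicator simp del: mem_Collect_eq
            simp: emeasure_eq_measure Int_absorb2 sets.sets_into_space)
      have "(\<integral>\<omega>. \<bar>X n \<omega> - c\<bar> powr p \<partial>M) \<le> (\<integral>\<omega>. d / 2 + indicat_real ?A \<omega> \<partial>M)"
      proof (rule integral_mono_AE)
        show "integrable M (\<lambda>\<omega>. d / 2 + indicat_real ?A \<omega>)"
          by (intro Bochner_Integration.integrable_add integrable_const ind)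
        show "AE \<omega> in M. \<bar>X n \<omega> - c\<bar> powr p \<le> d / 2 + indicat_real ?A \<omega>"
          using elim(3) AE_space
        proof eventually_elim
          case (elim \<omega>)
          show ?case
          proof (cases "\<bar>X n \<omega> - c\<bar> > e")
            case True
            have "\<bar>X n \<omega> - c\<bar> powr p \<le> 1" using elim p by (intro powr_le1) auto
            then show ?thesis using True elim d by simp
          next
            case False
            then have "\<bar>X n \<omega> - c\<bar> powr p \<le> e powr p" using p by (intro powr_mono2) auto
            then show ?thesis using False e by simp
          qed
        qed
      qed (use elim in auto)
      also have "\<dots> = d / 2 + prob ?A"
        by (simp only: Bochner_Integration.integral_add[OF integrable_const ind] ind_eq) (simp add: prob_space)
      also have "\<dots> < d" using elim by simp
      finally show ?case by (simp add: integral_nonneg_AE)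
    qed
  qed
  with int show ?thesis by (auto simp: converges_in_mean_def elim: eventually_mono)
qed

lemma converges_in_mean_of_AE:
  assumes meas: "\<forall>\<^sub>F n in sequentially. X n \<in> borel_measurable M"
    and conv: "AE \<omega> in M. (\<lambda>n. X n \<omega>) \<longlonglongrightarrow> c"
    and bound: "\<forall>\<^sub>F n in sequentially. AE \<omega> in M. \<bar>X n \<omega> - c\<bar> \<le> 1" and p: "p > 0"
  shows "converges_in_mean M p X (\<lambda>_. c)"
proof -
  have int: "\<forall>\<^sub>F n in sequentially. X n \<in> borel_measurable M \<and> integrable M (\<lambda>\<omega>. \<bar>X n \<omega> - c\<bar> powr p)"
    using meas bound by eventually_elim (auto intro: integrable_abs_diff_powr p)
  obtain m where m: "\<And>n. n \<ge> m \<Longrightarrow> X n \<in> borel_measurable M"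
    "\<And>n. n \<ge> m \<Longrightarrow> AE \<omega> in M. \<bar>X n \<omega> - c\<bar> \<le> 1"
    using eventually_conj[OF meas bound] by (auto simp: eventually_sequentially)
  have "(\<lambda>n. \<integral>\<omega>. \<bar>X (n + m) \<omega> - c\<bar> powr p \<partial>M) \<longlonglongrightarrow> (\<integral>\<omega>. 0 \<partial>M)"
  proof (rule integral_dominated_convergence[where w = "\<lambda>_. 1"])
    show "AE \<omega> in M. (\<lambda>n. \<bar>X (n + m) \<omega> - c\<bar> powr p) \<longlonglongrightarrow> 0"
      using conv
    proof eventually_elim
      case (elim \<omega>)
      then have "(\<lambda>n. \<bar>X (n + m) \<omega> - c\<bar>) \<longlonglongrightarrow> 0"
        by (intro tendsto_rabs_zero LIM_zero LIMSEQ_ignore_initial_segment)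
      from tendsto_powr'[OF this tendsto_const, of p] p show ?case by simp
    qed
    show "AE \<omega> in M. norm (\<bar>X (n + m) \<omega> - c\<bar> powr p) \<le> 1" for n
      using m(2)[of "n + m"] p by (auto elim!: eventually_mono intro: powr_le1)
    show "(\<lambda>\<omega>. \<bar>X (n + m) \<omega> - c\<bar> powr p) \<in> borel_measurable M" for n
      using m(1)[of "n + m"] by measurable
  qed auto
  then have "(\<lambda>n. \<integral>\<omega>. \<bar>X n \<omega> - c\<bar> powr p \<partial>M) \<longlonglongrightarrow> 0"
    by (simp add: LIMSEQ_offset[where k = m])
  with int show ?thesis by (auto simp: converges_in_mean_def elim: eventually_mono)
qed

lemma expectation_tendsto_of_mean:
  assumes conv: "converges_in_mean M 1 X (\<lambda>_. c)"
    and bound: "\<forall>\<^sub>F n in sequentially. AE \<omega> in M. \<bar>X n \<omega> - c\<bar> \<le> 1"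
  shows "(\<lambda>n. expectation (X n)) \<longlonglongrightarrow> c"
proof (rule LIM_zero_cancel, rule tendsto_rabs_zero_cancel, rule tendsto_sandwich[OF _ _ tendsto_const])
  show "(\<lambda>n. \<integral>\<omega>. \<bar>X n \<omega> - c\<bar> powr 1 \<partial>M) \<longlonglongrightarrow> 0"
    using conv by (simp add: converges_in_mean_def)
  have "\<forall>\<^sub>F n in sequentially. X n \<in> borel_measurable M"
    using conv by (auto simp: converges_in_mean_def elim: eventually_mono)
  then show "\<forall>\<^sub>F n in sequentially. \<bar>expectation (X n) - c\<bar> \<le> (\<integral>\<omega>. \<bar>X n \<omega> - c\<bar> powr 1 \<partial>M)"
    using bound
  proof eventually_elim
    case (elim n)
    have "AE \<omega> in M. norm (X n \<omega>) \<le> \<bar>c\<bar> + 1" using elim(2) by eventually_elim auto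
    then have int: "integrable M (X n)" using elim(1) by (rule integrable_const_bound)
    then have "expectation (X n) - c = (\<integral>\<omega>. X n \<omega> - c \<partial>M)" by (simp add: prob_space)
    then show ?case using integral_abs_bound[of M "\<lambda>\<omega>. X n \<omega> - c"] by simp
  qed
qed auto

end

section \<open>Zeros of random polynomials\<close>

lemma coeff_row_poly: "coeff (row_poly a N \<omega>) k = (if k \<le> N then a N k \<omega> else 0)"
  by (simp add: row_poly_def coeff_sum)

lemma degree_row_poly_le: "degree (row_poly a N \<omega>) \<le> N"
  by (rule degree_le) (simp add: coeff_row_poly)

lemma annulus_count_le: "annulus_count (row_poly a N \<omega>) \<rho> \<le> N"
  unfolding annulus_count_def
  by (meson degree_row_poly_le order_trans size_filter_mset_lesseq size_proots_le)

lemma sector_count_le: "sector_count (row_poly a N \<omega>) \<theta> \<phi> \<le> N"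
  unfolding sector_count_def
  by (meson degree_row_poly_le order_trans size_filter_mset_lesseq size_proots_le)

lemma factored_row_poly:
  assumes "a N 0 \<omega> \<noteq> 0" "a N N \<omega> \<noteq> 0"
  shows "\<exists>z. factored_poly (row_poly a N \<omega>) N z"
    and "poly_log_ratio (row_poly a N \<omega>) = log_ratio a N \<omega>"
proof -
  let ?p = "row_poly a N \<omega>"
  have deg: "degree ?p = N"
    using degree_row_poly_le[of a N \<omega>] assms by (intro antisym le_degree) (auto simp: coeff_row_poly)
  obtain z where z: "smult (lead_coeff ?p) (\<Prod>i<degree ?p. [:-z i, 1:]) = ?p"
    using complex_poly_decompose' by metis
  then have "factored_poly ?p N z"
    unfolding factored_poly_def using assms by (simp add: deg coeff_row_poly)
  then show "\<exists>z. factored_poly ?p N z" by blast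
  show "poly_log_ratio ?p = log_ratio a N \<omega>"
    unfolding poly_log_ratio_def log_ratio_def deg by (simp add: coeff_row_poly)
qed

lemma log_ratio_nonneg:
  assumes "a N 0 \<omega> \<noteq> 0" "a N N \<omega> \<noteq> 0"
  shows "log_ratio a N \<omega> \<ge> 0"
  using factored_row_poly[of a N \<omega>, OF assms] factored_poly.poly_log_ratio_nonneg by metis

lemma annulus_frac_bound:
  assumes "a N 0 \<omega> \<noteq> 0" "a N N \<omega> \<noteq> 0" and N: "N \<ge> 1" and r: "0 < r" "r \<le> real N"
  shows "\<bar>real (annulus_count (row_poly a N \<omega>) (r / real N)) / real N - 1\<bar> \<le> 2 * (log_ratio a N \<omega> / r)"
proof -
  have "real N - real (annulus_count (row_poly a N \<omega>) (r / real N))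
      \<le> 2 * log_ratio a N \<omega> / (r / real N)"
    using factored_row_poly[of a N \<omega>, OF assms(1,2)] factored_poly.annulus_count_ge[of _ N _ "r / real N"] N r
    by (metis divide_le_eq_1_pos divide_pos_pos of_nat_0_less_iff less_eq_Suc_le One_nat_def)
  then show ?thesis
    using annulus_count_le[of a N \<omega> "r / real N"] log_ratio_nonneg[of a N \<omega>, OF assms(1,2)] N r by (simp add: field_simps abs_if)
qed

lemma sector_frac_bound:
  assumes "0 \<le> \<theta>" "\<theta> \<le> \<phi>" "\<phi> \<le> 2 * pi" "e > 0"
  shows "\<exists>C\<ge>0. \<forall>a N \<omega>. a N 0 \<omega> \<noteq> 0 \<and> a N N \<omega> \<noteq> 0 \<and> N \<ge> 1 \<longrightarrow>
     \<bar>real (sector_count (row_poly a N \<omega>) \<theta> \<phi>) / real N - (\<phi> - \<theta>) / (2 * pi)\<bar>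
       \<le> e + C * (log_ratio a N \<omega> / real N)"
proof -
  obtain C where C: "C \<ge> 0" "\<forall>p n z. factored_poly p n z \<longrightarrow>
     \<bar>real (sector_count p \<theta> \<phi>) - real n * ((\<phi> - \<theta>) / (2 * pi))\<bar> \<le> real n * e + C * poly_log_ratio p"
    using sector_count_equidistribution[OF assms] by blast
  show ?thesis
  proof (intro exI[of _ C] conjI allI impI C(1))
    fix a :: "nat \<Rightarrow> nat \<Rightarrow> 'a \<Rightarrow> complex" and N \<omega>
    assume nz: "a N 0 \<omega> \<noteq> 0 \<and> a N N \<omega> \<noteq> 0 \<and> N \<ge> 1"
    define x where "x = real (sector_count (row_poly a N \<omega>) \<theta> \<phi>)"
    define y where "y = (\<phi> - \<theta>) / (2 * pi)"
    have N: "real N > 0" using nz by simp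
    have "\<bar>x - real N * y\<bar> \<le> real N * e + C * log_ratio a N \<omega>"
      using factored_row_poly[of a N \<omega>] nz C(2) unfolding x_def y_def by metis
    then have "\<bar>x - real N * y\<bar> / real N \<le> (real N * e + C * log_ratio a N \<omega>) / real N"
      using N by (intro divide_right_mono) auto
    moreover have "\<bar>x - real N * y\<bar> / real N = \<bar>x / real N - y\<bar>"
    proof -
      have "x / real N - y = (x - real N * y) / real N" using N by (simp add: field_simps)
      then show ?thesis using N by simp
    qed
    moreover have "(real N * e + C * log_ratio a N \<omega>) / real N = e + C * (log_ratio a N \<omega> / real N)"
      using N by (simp add: field_simps)
    ultimately show "\<bar>x / real N - y\<bar> \<le> e + C * (log_ratio a N \<omega> / real N)" by simp
  qed
qed

theorem theorem5:
  fixes M :: "'w measure" and a :: "nat \<Rightarrow> nat \<Rightarrow> 'w \<Rightarrow> complex"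
  assumes "prob_space M"
    and "\<And>N k. 1 \<le> N \<Longrightarrow> k \<le> N \<Longrightarrow> a N k \<in> borel_measurable M"
    and "\<And>N. 1 \<le> N \<Longrightarrow> measure M {\<omega> \<in> space M. a N 0 \<omega> = 0} = 0"
    and "\<And>N. 1 \<le> N \<Longrightarrow> measure M {\<omega> \<in> space M. a N N \<omega> = 0} = 0"
  defines "annulus_frac \<equiv> \<lambda>\<alpha> N \<omega>. real (annulus_count (row_poly a N \<omega>) (\<alpha> N / real N)) / real N"
    and "sector_frac \<equiv> \<lambda>\<theta> \<phi> N \<omega>. real (sector_count (row_poly a N \<omega>) \<theta> \<phi>) / real N"
  shows
    "((\<forall>\<^sub>F N in sequentially. integrable M (log_ratio a N)) \<and>
      (\<lambda>N. \<integral>\<omega>. log_ratio a N \<omega> \<partial>M) \<in> o(\<lambda>N. real N) \<longrightarrow>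
        (\<exists>\<alpha> :: nat \<Rightarrow> real. (\<forall>N\<ge>1. 0 < \<alpha> N) \<and> \<alpha> \<in> o(\<lambda>N. real N) \<and>
           (\<lambda>N. \<integral>\<omega>. annulus_frac \<alpha> N \<omega> \<partial>M) \<longlonglongrightarrow> 1 \<and>
           converges_in_probability M (annulus_frac \<alpha>) (\<lambda>_. 1) \<and>
           (\<forall>p>0. converges_in_mean M p (annulus_frac \<alpha>) (\<lambda>_. 1))) \<and>
        (\<forall>\<theta> \<phi>. 0 \<le> \<theta> \<and> \<theta> < \<phi> \<and> \<phi> \<le> 2 * pi \<longrightarrow>
           (\<lambda>N. \<integral>\<omega>. sector_frac \<theta> \<phi> N \<omega> \<partial>M) \<longlonglongrightarrow> (\<phi> - \<theta>) / (2 * pi) \<and>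
           converges_in_probability M (sector_frac \<theta> \<phi>) (\<lambda>_. (\<phi> - \<theta>) / (2 * pi)) \<and>
           (\<forall>p>0. converges_in_mean M p (sector_frac \<theta> \<phi>) (\<lambda>_. (\<phi> - \<theta>) / (2 * pi)))))
     \<and>
     (\<forall>\<alpha> :: nat \<Rightarrow> real.
        (\<forall>N\<ge>1. 0 < \<alpha> N \<and> \<alpha> N \<le> real N) \<and>
        (AE \<omega> in M. (\<lambda>N. log_ratio a N \<omega> / \<alpha> N) \<longlonglongrightarrow> 0) \<longrightarrow>
          (AE \<omega> in M. (\<lambda>N. annulus_frac \<alpha> N \<omega>) \<longlonglongrightarrow> 1) \<and>
          (\<forall>p>0. converges_in_mean M p (annulus_frac \<alpha>) (\<lambda>_. 1)) \<and>
          (\<forall>\<theta> \<phi>. 0 \<le> \<theta> \<and> \<theta> < \<phi> \<and> \<phi> \<le> 2 * pi \<longrightarrow>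
             (AE \<omega> in M. (\<lambda>N. sector_frac \<theta> \<phi> N \<omega>) \<longlonglongrightarrow> (\<phi> - \<theta>) / (2 * pi)) \<and>
             (\<forall>p>0. converges_in_mean M p (sector_frac \<theta> \<phi>) (\<lambda>_. (\<phi> - \<theta>) / (2 * pi)))))"
proof -
  interpret prob_space M by fact
  have nz_AE: "AE \<omega> in M. \<forall>N\<ge>1. a N 0 \<omega> \<noteq> 0 \<and> a N N \<omega> \<noteq> 0"
  proof (subst AE_all_countable, intro allI)
    fix N :: nat
    have AE_nz: "AE \<omega> in M. a N k \<omega> \<noteq> 0"
      if "1 \<le> N" "k \<le> N" "prob {\<omega> \<in> space M. a N k \<omega> = 0} = 0" for k
    proof -
      have "a N k -` {0} \<inter> space M \<in> sets M"
        using assms(2)[OF that(1,2)] by (rule measurable_sets) simp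
      then have "{\<omega> \<in> space M. a N k \<omega> = 0} \<in> events" by (simp add: vimage_def Int_def conj_commute)
      with that(3) show ?thesis by (simp add: prob_eq_0)
    qed
    show "AE \<omega> in M. 1 \<le> N \<longrightarrow> a N 0 \<omega> \<noteq> 0 \<and> a N N \<omega> \<noteq> 0"
    proof (cases "1 \<le> N")
      case True
      then have "AE \<omega> in M. a N 0 \<omega> \<noteq> 0" "AE \<omega> in M. a N N \<omega> \<noteq> 0"
        by (auto intro!: AE_nz assms(3,4))
      then show ?thesis by eventually_elim simp
    qed simp
  qed
  have nz: "AE \<omega> in M. a N 0 \<omega> \<noteq> 0 \<and> a N N \<omega> \<noteq> 0" if "N \<ge> 1" for N
    using nz_AE by eventually_elim (use that in blast)
  have annulus_meas: "\<forall>\<^sub>F N in sequentially. annulus_frac \<alpha> N \<in> borel_measurable M" for \<alpha>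
    using eventually_ge_at_top[of 1]
  proof eventually_elim
    case (elim N)
    show ?case
      unfolding annulus_frac_def
      using measurable_annulus_count[of N a M "\<alpha> N / real N"] assms(2)[OF elim] by simp
  qed
  have sector_meas: "\<forall>\<^sub>F N in sequentially. sector_frac \<theta> \<phi> N \<in> borel_measurable M"
    if "0 \<le> \<theta>" "\<theta> < \<phi>" "\<phi> \<le> 2 * pi" for \<theta> \<phi>
    using eventually_ge_at_top[of 1]
  proof eventually_elim
    case (elim N)
    show ?case
      unfolding sector_frac_def
      using measurable_sector_count[of N a M \<theta> \<phi>] assms(2)[OF elim] that by simp
  qed
  have frac01: "0 \<le> annulus_frac \<alpha> N \<omega>" "annulus_frac \<alpha> N \<omega> \<le> 1"
    "0 \<le> sector_frac \<theta> \<phi> N \<omega>" "sector_frac \<theta> \<phi> N \<omega> \<le> 1" for \<alpha> N \<omega> \<theta> \<phi>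
    using annulus_count_le[of a N \<omega>] sector_count_le[of a N \<omega> \<theta> \<phi>]
    by (auto simp: annulus_frac_def sector_frac_def divide_le_eq_1)
  have annulus_le: "\<bar>annulus_frac \<alpha> N \<omega> - 1\<bar> \<le> 1" for \<alpha> N \<omega>
    using frac01(1,2)[of \<alpha> N \<omega>] by linarith
  have sector_le: "\<bar>sector_frac \<theta> \<phi> N \<omega> - (\<phi> - \<theta>) / (2 * pi)\<bar> \<le> 1"
    if "0 \<le> \<theta>" "\<theta> < \<phi>" "\<phi> \<le> 2 * pi" for \<theta> \<phi> N \<omega>
  proof -
    have "0 \<le> (\<phi> - \<theta>) / (2 * pi)" "(\<phi> - \<theta>) / (2 * pi) \<le> 1" using that by (auto simp: divide_le_eq_1)
    then show ?thesis using frac01(3,4)[of \<theta> \<phi> N \<omega>] by linarith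
  qed
  show ?thesis
  proof (intro conjI impI)
    assume H: "(\<forall>\<^sub>F N in sequentially. integrable M (log_ratio a N)) \<and>
      (\<lambda>N. expectation (log_ratio a N)) \<in> o(\<lambda>N. real N)"
    then have L_int: "\<forall>\<^sub>F N in sequentially. integrable M (log_ratio a N)"
      and L_o: "(\<lambda>N. expectation (log_ratio a N)) \<in> o(\<lambda>N. real N)" by auto
    have L_nonneg: "\<forall>\<^sub>F N in sequentially. AE \<omega> in M. 0 \<le> log_ratio a N \<omega>"
      using eventually_ge_at_top[of 1]
    proof eventually_elim
      case (elim N)
      show ?case using nz[OF elim] by eventually_elim (simp add: log_ratio_nonneg)
    qed
    have L_lim: "(\<lambda>N. expectation (log_ratio a N) / real N) \<longlonglongrightarrow> 0"
      using L_o by (rule smalloD_tendsto)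
    \<comment> \<open>\<open>\<alpha> N / N\<close> must tend to zero more slowly than \<open>E L / N\<close>; the square root achieves this, and the summand \<open>1 / N\<close> keeps it positive\<close>
    define s where "s = (\<lambda>N. \<bar>expectation (log_ratio a N) / real N\<bar> + 1 / real N)"
    define \<alpha> where "\<alpha> = (\<lambda>N. real N * sqrt (s N))"
    have s_pos: "s N > 0" if "N \<ge> 1" for N using that by (auto simp: s_def intro: add_nonneg_pos)
    have \<alpha>_pos: "\<alpha> N > 0" if "N \<ge> 1" for N using that s_pos[OF that] by (simp add: \<alpha>_def)
    have "s \<longlonglongrightarrow> 0 + 0"
      unfolding s_def by (intro tendsto_add tendsto_rabs_zero L_lim lim_1_over_n)
    then have s_lim: "(\<lambda>N. sqrt (s N)) \<longlonglongrightarrow> 0" using tendsto_real_sqrt by fastforce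
    have ge1: "\<forall>\<^sub>F N :: nat in sequentially. N \<ge> 1" by (rule eventually_ge_at_top)
    have \<alpha>_o: "\<alpha> \<in> o(\<lambda>N. real N)"
    proof (rule smalloI_tendsto)
      show "(\<lambda>N. \<alpha> N / real N) \<longlonglongrightarrow> 0"
        by (rule Lim_transform_eventually[OF s_lim]) (use ge1 in eventually_elim, simp add: \<alpha>_def)
      show "\<forall>\<^sub>F N in sequentially. real N \<noteq> 0" using ge1 by eventually_elim simp
    qed
    have \<alpha>_le: "\<forall>\<^sub>F N in sequentially. \<alpha> N \<le> real N"
      using order_tendstoD(2)[OF s_lim zero_less_one]
      by eventually_elim (simp add: \<alpha>_def mult_left_le)
    have ratio_lim: "(\<lambda>N. expectation (\<lambda>\<omega>. log_ratio a N \<omega> / \<alpha> N)) \<longlonglongrightarrow> 0"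
    proof (rule tendsto_rabs_zero_cancel, rule tendsto_sandwich[OF _ _ tendsto_const s_lim])
      show "\<forall>\<^sub>F N in sequentially. \<bar>expectation (\<lambda>\<omega>. log_ratio a N \<omega> / \<alpha> N)\<bar> \<le> sqrt (s N)"
        using ge1
      proof eventually_elim
        case (elim N)
        have sq: "sqrt (s N) > 0" "sqrt (s N) * sqrt (s N) = s N" using s_pos[OF elim] by auto
        have "\<bar>expectation (\<lambda>\<omega>. log_ratio a N \<omega> / \<alpha> N)\<bar> = \<bar>expectation (log_ratio a N) / real N\<bar> / sqrt (s N)"
          using sq elim by (simp add: \<alpha>_def abs_mult)
        also have "\<dots> \<le> s N / sqrt (s N)"
          using sq by (intro divide_right_mono) (auto simp: s_def)
        also have "\<dots> = sqrt (s N)" using sq by (simp add: field_simps)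
        finally show ?case .
      qed
    qed simp
    have annulus_prob: "converges_in_probability M (annulus_frac \<alpha>) (\<lambda>_. 1)"
    proof (rule converges_in_probability_of_affine_bound[OF annulus_meas _ _ ratio_lim])
      show "\<forall>\<^sub>F N in sequentially. integrable M (\<lambda>\<omega>. log_ratio a N \<omega> / \<alpha> N)"
        using L_int by eventually_elim simp
      show "\<forall>\<^sub>F N in sequentially. AE \<omega> in M. 0 \<le> log_ratio a N \<omega> / \<alpha> N"
        using L_nonneg ge1
      proof eventually_elim
        case (elim N)
        from elim(1) show ?case by eventually_elim (use \<alpha>_pos[OF elim(2)] in simp)
      qed
      fix e :: real assume e: "e > 0"
      have "\<forall>\<^sub>F N in sequentially. AE \<omega> in M. \<bar>annulus_frac \<alpha> N \<omega> - 1\<bar> \<le> e + 2 * (log_ratio a N \<omega> / \<alpha> N)"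
        using ge1 \<alpha>_le
      proof eventually_elim
        case (elim N)
        from nz[OF elim(1)] show ?case
        proof eventually_elim
          case (elim \<omega>)
          have "\<bar>annulus_frac \<alpha> N \<omega> - 1\<bar> \<le> 2 * (log_ratio a N \<omega> / \<alpha> N)"
            unfolding annulus_frac_def
            using elim \<open>1 \<le> N\<close> \<open>\<alpha> N \<le> real N\<close> \<alpha>_pos[of N] by (intro annulus_frac_bound) auto
          with e show ?case by linarith
        qed
      qed
      then show "\<exists>C\<ge>0. \<forall>\<^sub>F N in sequentially. AE \<omega> in M. \<bar>annulus_frac \<alpha> N \<omega> - 1\<bar> \<le> e + C * (log_ratio a N \<omega> / \<alpha> N)"
        by (intro exI[of _ 2]) simp
    qed
    have annulus_mean: "converges_in_mean M p (annulus_frac \<alpha>) (\<lambda>_. 1)" if "p > 0" for p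
      by (rule converges_in_mean_of_probability[OF annulus_prob _ that]) (simp add: annulus_le)
    have annulus_exp: "(\<lambda>N. expectation (annulus_frac \<alpha> N)) \<longlonglongrightarrow> 1"
      by (rule expectation_tendsto_of_mean[OF annulus_mean]) (simp_all add: annulus_le)
    show "\<exists>\<alpha> :: nat \<Rightarrow> real. (\<forall>N\<ge>1. 0 < \<alpha> N) \<and> \<alpha> \<in> o(\<lambda>N. real N) \<and>
           (\<lambda>N. expectation (annulus_frac \<alpha> N)) \<longlonglongrightarrow> 1 \<and>
           converges_in_probability M (annulus_frac \<alpha>) (\<lambda>_. 1) \<and>
           (\<forall>p>0. converges_in_mean M p (annulus_frac \<alpha>) (\<lambda>_. 1))"
      using \<alpha>_pos \<alpha>_o annulus_exp annulus_prob annulus_mean by blast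
    show "\<forall>\<theta> \<phi>. 0 \<le> \<theta> \<and> \<theta> < \<phi> \<and> \<phi> \<le> 2 * pi \<longrightarrow>
           (\<lambda>N. expectation (sector_frac \<theta> \<phi> N)) \<longlonglongrightarrow> (\<phi> - \<theta>) / (2 * pi) \<and>
           converges_in_probability M (sector_frac \<theta> \<phi>) (\<lambda>_. (\<phi> - \<theta>) / (2 * pi)) \<and>
           (\<forall>p>0. converges_in_mean M p (sector_frac \<theta> \<phi>) (\<lambda>_. (\<phi> - \<theta>) / (2 * pi)))"
    proof (intro allI impI)
      fix \<theta> \<phi> :: real
      assume "0 \<le> \<theta> \<and> \<theta> < \<phi> \<and> \<phi> \<le> 2 * pi"
      then have arc: "0 \<le> \<theta>" "\<theta> < \<phi>" "\<phi> \<le> 2 * pi" by auto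
      let ?c = "(\<phi> - \<theta>) / (2 * pi)"
      have prob: "converges_in_probability M (sector_frac \<theta> \<phi>) (\<lambda>_. ?c)"
      proof (rule converges_in_probability_of_affine_bound[OF sector_meas[OF arc], where Z = "\<lambda>N \<omega>. log_ratio a N \<omega> / real N"])
        show "\<forall>\<^sub>F N in sequentially. integrable M (\<lambda>\<omega>. log_ratio a N \<omega> / real N)"
          using L_int by eventually_elim simp
        show "\<forall>\<^sub>F N in sequentially. AE \<omega> in M. 0 \<le> log_ratio a N \<omega> / real N"
          using L_nonneg by eventually_elim (auto elim!: eventually_mono)
        show "(\<lambda>N. expectation (\<lambda>\<omega>. log_ratio a N \<omega> / real N)) \<longlonglongrightarrow> 0"
          using L_lim by simp
        fix e :: real assume e: "e > 0"
        obtain C where C: "C \<ge> 0" "\<And>a N (\<omega> :: 'w). a N 0 \<omega> \<noteq> 0 \<and> a N N \<omega> \<noteq> 0 \<and> N \<ge> 1 \<Longrightarrow>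
            \<bar>real (sector_count (row_poly a N \<omega>) \<theta> \<phi>) / real N - ?c\<bar> \<le> e + C * (log_ratio a N \<omega> / real N)"
          using sector_frac_bound[of \<theta> \<phi> e, where 'a = 'w] arc e by fastforce
        have "\<forall>\<^sub>F N in sequentially. AE \<omega> in M. \<bar>sector_frac \<theta> \<phi> N \<omega> - ?c\<bar> \<le> e + C * (log_ratio a N \<omega> / real N)"
          using ge1
        proof eventually_elim
          case (elim N)
          show ?case
            using nz[OF elim] by eventually_elim (use elim C(2)[of a N] in \<open>simp add: sector_frac_def\<close>)
        qed
        with C(1) show "\<exists>C\<ge>0. \<forall>\<^sub>F N in sequentially. AE \<omega> in M. \<bar>sector_frac \<theta> \<phi> N \<omega> - ?c\<bar>
            \<le> e + C * (log_ratio a N \<omega> / real N)" by blast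
      qed
      have mean: "converges_in_mean M p (sector_frac \<theta> \<phi>) (\<lambda>_. ?c)" if "p > 0" for p
        by (rule converges_in_mean_of_probability[OF prob _ that]) (simp add: sector_le[OF arc])
      have "(\<lambda>N. expectation (sector_frac \<theta> \<phi> N)) \<longlonglongrightarrow> ?c"
        by (rule expectation_tendsto_of_mean[OF mean]) (simp_all add: sector_le[OF arc])
      with prob mean show "(\<lambda>N. expectation (sector_frac \<theta> \<phi> N)) \<longlonglongrightarrow> ?c \<and>
           converges_in_probability M (sector_frac \<theta> \<phi>) (\<lambda>_. ?c) \<and>
           (\<forall>p>0. converges_in_mean M p (sector_frac \<theta> \<phi>) (\<lambda>_. ?c))" by blast
    qed
  next
    show "\<forall>\<alpha> :: nat \<Rightarrow> real.
        (\<forall>N\<ge>1. 0 < \<alpha> N \<and> \<alpha> N \<le> real N) \<and>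
        (AE \<omega> in M. (\<lambda>N. log_ratio a N \<omega> / \<alpha> N) \<longlonglongrightarrow> 0) \<longrightarrow>
          (AE \<omega> in M. (\<lambda>N. annulus_frac \<alpha> N \<omega>) \<longlonglongrightarrow> 1) \<and>
          (\<forall>p>0. converges_in_mean M p (annulus_frac \<alpha>) (\<lambda>_. 1)) \<and>
          (\<forall>\<theta> \<phi>. 0 \<le> \<theta> \<and> \<theta> < \<phi> \<and> \<phi> \<le> 2 * pi \<longrightarrow>
             (AE \<omega> in M. (\<lambda>N. sector_frac \<theta> \<phi> N \<omega>) \<longlonglongrightarrow> (\<phi> - \<theta>) / (2 * pi)) \<and>
             (\<forall>p>0. converges_in_mean M p (sector_frac \<theta> \<phi>) (\<lambda>_. (\<phi> - \<theta>) / (2 * pi))))"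
    proof (intro allI impI)
      fix \<alpha> :: "nat \<Rightarrow> real"
      assume "(\<forall>N\<ge>1. 0 < \<alpha> N \<and> \<alpha> N \<le> real N) \<and> (AE \<omega> in M. (\<lambda>N. log_ratio a N \<omega> / \<alpha> N) \<longlonglongrightarrow> 0)"
      then have \<alpha>: "\<And>N. N \<ge> 1 \<Longrightarrow> 0 < \<alpha> N" "\<And>N. N \<ge> 1 \<Longrightarrow> \<alpha> N \<le> real N"
        and lim: "AE \<omega> in M. (\<lambda>N. log_ratio a N \<omega> / \<alpha> N) \<longlonglongrightarrow> 0" by auto
      have ge1: "\<forall>\<^sub>F N :: nat in sequentially. N \<ge> 1" by (rule eventually_ge_at_top)
      have annulus_AE: "AE \<omega> in M. (\<lambda>N. annulus_frac \<alpha> N \<omega>) \<longlonglongrightarrow> 1"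
        using nz_AE lim
      proof eventually_elim
        case (elim \<omega>)
        have "(\<lambda>N. annulus_frac \<alpha> N \<omega> - 1) \<longlonglongrightarrow> 0"
        proof (rule Lim_null_comparison)
          show "\<forall>\<^sub>F N in sequentially. norm (annulus_frac \<alpha> N \<omega> - 1) \<le> 2 * (log_ratio a N \<omega> / \<alpha> N)"
            using ge1
            unfolding annulus_frac_def real_norm_def
            by eventually_elim (use elim \<alpha> in \<open>intro annulus_frac_bound; simp\<close>)
          show "(\<lambda>N. 2 * (log_ratio a N \<omega> / \<alpha> N)) \<longlonglongrightarrow> 0"
            using tendsto_mult_left[OF elim(2), of 2] by simp
        qed
        then show ?case by (rule LIM_zero_cancel)
      qed
      have annulus_mean: "converges_in_mean M p (annulus_frac \<alpha>) (\<lambda>_. 1)" if "p > 0" for p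
        by (rule converges_in_mean_of_AE[OF annulus_meas annulus_AE _ that]) (simp add: annulus_le)
      have "(AE \<omega> in M. (\<lambda>N. sector_frac \<theta> \<phi> N \<omega>) \<longlonglongrightarrow> (\<phi> - \<theta>) / (2 * pi)) \<and>
             (\<forall>p>0. converges_in_mean M p (sector_frac \<theta> \<phi>) (\<lambda>_. (\<phi> - \<theta>) / (2 * pi)))"
        if arc: "0 \<le> \<theta>" "\<theta> < \<phi>" "\<phi> \<le> 2 * pi" for \<theta> \<phi>
      proof
        let ?c = "(\<phi> - \<theta>) / (2 * pi)"
        show AE: "AE \<omega> in M. (\<lambda>N. sector_frac \<theta> \<phi> N \<omega>) \<longlonglongrightarrow> ?c"
          using nz_AE lim
        proof eventually_elim
          case (elim \<omega>)
          have L0: "(\<lambda>N. log_ratio a N \<omega> / real N) \<longlonglongrightarrow> 0"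
          proof (rule Lim_null_comparison[OF _ elim(2)])
            show "\<forall>\<^sub>F N in sequentially. norm (log_ratio a N \<omega> / real N) \<le> log_ratio a N \<omega> / \<alpha> N"
              using ge1
            proof eventually_elim
              fix N :: nat assume N: "1 \<le> N"
              then have "log_ratio a N \<omega> \<ge> 0" using elim(1) by (intro log_ratio_nonneg) auto
              then show "norm (log_ratio a N \<omega> / real N) \<le> log_ratio a N \<omega> / \<alpha> N"
                using \<alpha>[OF N] by (simp add: frac_le)
            qed
          qed
          show ?case
          proof (rule tendstoI)
            fix e :: real assume e: "e > 0"
            obtain C where C: "C \<ge> 0" "\<And>a N (\<omega> :: 'w). a N 0 \<omega> \<noteq> 0 \<and> a N N \<omega> \<noteq> 0 \<and> N \<ge> 1 \<Longrightarrow>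
              \<bar>real (sector_count (row_poly a N \<omega>) \<theta> \<phi>) / real N - ?c\<bar> \<le> e / 2 + C * (log_ratio a N \<omega> / real N)"
              using sector_frac_bound[of \<theta> \<phi> "e / 2", where 'a = 'w] arc e by fastforce
            have "(\<lambda>N. C * (log_ratio a N \<omega> / real N)) \<longlonglongrightarrow> 0"
              using tendsto_mult_left[OF L0, of C] by simp
            then have "\<forall>\<^sub>F N in sequentially. C * (log_ratio a N \<omega> / real N) < e / 2"
              by (rule order_tendstoD(2)) (use e in simp)
            with ge1 show "\<forall>\<^sub>F N in sequentially. dist (sector_frac \<theta> \<phi> N \<omega>) ?c < e"
            proof eventually_elim
              fix N :: nat assume N: "1 \<le> N" and small: "C * (log_ratio a N \<omega> / real N) < e / 2"
              have "\<bar>sector_frac \<theta> \<phi> N \<omega> - ?c\<bar> \<le> e / 2 + C * (log_ratio a N \<omega> / real N)"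
                unfolding sector_frac_def using elim(1) N by (intro C(2)) blast
              with small show "dist (sector_frac \<theta> \<phi> N \<omega>) ?c < e" unfolding dist_real_def by linarith
            qed
          qed
        qed
        show "\<forall>p>0. converges_in_mean M p (sector_frac \<theta> \<phi>) (\<lambda>_. ?c)"
          by (intro allI impI converges_in_mean_of_AE[OF sector_meas[OF arc] AE]) (simp_all add: sector_le[OF arc])
      qed
      with annulus_AE annulus_mean show "(AE \<omega> in M. (\<lambda>N. annulus_frac \<alpha> N \<omega>) \<longlonglongrightarrow> 1) \<and>
          (\<forall>p>0. converges_in_mean M p (annulus_frac \<alpha>) (\<lambda>_. 1)) \<and>
          (\<forall>\<theta> \<phi>. 0 \<le> \<theta> \<and> \<theta> < \<phi> \<and> \<phi> \<le> 2 * pi \<longrightarrow>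
             (AE \<omega> in M. (\<lambda>N. sector_frac \<theta> \<phi> N \<omega>) \<longlonglongrightarrow> (\<phi> - \<theta>) / (2 * pi)) \<and>
             (\<forall>p>0. converges_in_mean M p (sector_frac \<theta> \<phi>) (\<lambda>_. (\<phi> - \<theta>) / (2 * pi))))" by blast
    qed
  qed
qed

end
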